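(* Let $k$ be a field, let $I$ be a monomial ideal in $R=k[x_1,\dots,x_n]$, and suppose that $J$ and $K$ are monomial ideals in $R$ such that $\mathcal{G}(I)$ is the disjoint union of $\mathcal{G}(J)$ and $\mathcal{G}(K)$. Suppose that for all $i$ and all (multi)degrees $j$, $\beta_{i,j}(J\cap K)>0$ implies that $\beta_{i,j}(J)=\beta_{i,j}(K)=0$. Then $$\beta_{i,j}(I)=\beta_{i,j}(J)+\beta_{i,j}(K)+\beta_{i-1,j}(J\cap K)$$ for all $i$ and all (multi)degrees $j$; that is, $I=J+K$ is a Betti splitting.
   Context: $\mathcal{G}(L)$ denotes the unique set of minimal monomial generators of a monomial ideal $L$. The ring $R$ is graded either by the standard grading ($\deg x_i=1$) or by the standard multigrading ($\deg x_i$ is the $i$-th unit vector of $\mathbb{N}^n$); "(multi)degree" means a degree in whichever of these two gradings has been chosen (the same one in hypothesis and conclusion), and the result is asserted for either choice. $\beta_{i,j}(L)=\dim_k\operatorname{Tor}^R_i(k,L)_j$ is the $i,j$-th (multi)graded Betti number, with $\beta_{-1,j}=0$. Betti splitting: if $\mathcal{G}(I)$ is the disjoint union of $\mathcal{G}(J)$ and $\mathcal{G}(K)$, then $I=J+K$ is a Betti splitting if $\beta_{i,j}(I)=\beta_{i,j}(J)+\beta_{i,j}(K)+\beta_{i-1,j}(J\cap K)$ for all $i\in\mathbb{N}$ and all (multi)degrees $j$. *)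

theory Defs
  imports "HOL.Modules" "HOL-Library.Poly_Mapping"
begin

text \<open>
  The polynomial ring \<open>k[x\<^sub>1, \<dots>, x\<^sub>n]\<close> is the monoid algebra of the exponent vectors
  \<open>'n \<Rightarrow>\<^sub>0 nat\<close> over \<open>'k\<close>; the variables are indexed by the finite type \<open>'n\<close>, so
  \<open>n = CARD('n)\<close>.
\<close>

type_synonym 'n monom = "'n \<Rightarrow>\<^sub>0 nat"
type_synonym ('n, 'k) polyring = "'n monom \<Rightarrow>\<^sub>0 'k"

section \<open>Monomial ideals\<close>

definition monomials :: "('n, 'k::field) polyring set" where
  "monomials = {Poly_Mapping.single m 1 | m. True}"

definition ideal_gen :: "('n, 'k::field) polyring set \<Rightarrow> ('n, 'k) polyring set" where
  "ideal_gen G = module.span (*) G"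

definition monomial_ideal :: "('n, 'k::field) polyring set \<Rightarrow> bool" where
  "monomial_ideal L \<longleftrightarrow> (\<exists>M \<subseteq> monomials. L = ideal_gen M)"

text \<open>\<open>\<G>(L)\<close>, the unique inclusion-minimal generating set of \<open>L\<close> consisting of monomials.\<close>

definition min_gens :: "('n, 'k::field) polyring set \<Rightarrow> ('n, 'k) polyring set" where
  "min_gens L =
     (THE G. G \<subseteq> monomials \<and> ideal_gen G = L \<and> (\<forall>H. H \<subset> G \<longrightarrow> ideal_gen H \<noteq> L))"

section \<open>Gradings\<close>

text \<open>
  A grading is given by the degree of each monomial: its total degree (standard grading) or its
  exponent vector (standard multigrading).
\<close>

definition std_degree :: "'n::finite monom \<Rightarrow> nat" where
  "std_degree m = (\<Sum>v\<in>UNIV. Poly_Mapping.lookup m v)"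

definition multi_degree :: "'n::finite monom \<Rightarrow> 'n monom" where
  "multi_degree m = m"

section \<open>Graded free resolutions of the residue field\<close>

text \<open>
  A complex \<open>\<dots> \<rightarrow> F\<^sub>2 \<rightarrow> F\<^sub>1 \<rightarrow> F\<^sub>0 \<rightarrow> k \<rightarrow> 0\<close> where \<open>F\<^sub>i\<close> is free on the basis elements
  \<open>e\<^sub>p\<close>, \<open>p < res_rank F i\<close>, with \<open>e\<^sub>p\<close> of degree \<open>res_shift F i p\<close>.
  The differential \<open>F\<^sub>i\<^sub>+\<^sub>1 \<rightarrow> F\<^sub>i\<close> sends \<open>e\<^sub>p\<close> to \<open>\<Sum>\<^sub>q res_mat F i p q \<cdot> e\<^sub>q\<close>, and the
  augmentation \<open>F\<^sub>0 \<rightarrow> k\<close> sends \<open>e\<^sub>p\<close> to \<open>res_aug F p\<close>.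
\<close>

record (overloaded) ('g, 'n, 'k) free_complex =
  res_rank :: "nat \<Rightarrow> nat"
  res_shift :: "nat \<Rightarrow> nat \<Rightarrow> 'g"
  res_mat :: "nat \<Rightarrow> nat \<Rightarrow> nat \<Rightarrow> ('n, 'k::zero) polyring"
  res_aug :: "nat \<Rightarrow> 'k"

text \<open>
  \<open>vecs L r\<close> is \<open>L\<^sup>r\<close>. For an ideal \<open>L\<close> of \<open>R\<close> this is \<open>R\<^sup>r \<otimes>\<^sub>R L\<close>, and the map that
  a matrix over \<open>R\<close> induces on \<open>R\<^sup>r \<otimes>\<^sub>R L\<close> is the restriction of the map it defines on
  \<open>R\<^sup>r\<close>.
\<close>

definition vecs :: "('n, 'k::field) polyring set \<Rightarrow> nat \<Rightarrow> (nat \<Rightarrow>\<^sub>0 ('n, 'k) polyring) set" where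
  "vecs L r = {v. Poly_Mapping.keys v \<subseteq> {..<r} \<and> (\<forall>p<r. Poly_Mapping.lookup v p \<in> L)}"

definition res_diff ::
  "('g, 'n, 'k::field) free_complex \<Rightarrow> nat \<Rightarrow>
     (nat \<Rightarrow>\<^sub>0 ('n, 'k) polyring) \<Rightarrow> (nat \<Rightarrow>\<^sub>0 ('n, 'k) polyring)" where
  "res_diff F i v =
     (\<Sum>q<res_rank F i. Poly_Mapping.single q
        (\<Sum>p<res_rank F (Suc i). Poly_Mapping.lookup v p * res_mat F i p q))"

text \<open>
  The residue field \<open>k = R / (x\<^sub>1, \<dots>, x\<^sub>n)\<close> is an \<open>R\<close>-module through the constant
  coefficient, i.e. the coefficient at the exponent vector \<open>0\<close>.
\<close>

definition res_augment ::
  "('g, 'n, 'k::field) free_complex \<Rightarrow> (nat \<Rightarrow>\<^sub>0 ('n, 'k) polyring) \<Rightarrow> 'k" where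
  "res_augment F v =
     (\<Sum>p<res_rank F 0. Poly_Mapping.lookup (Poly_Mapping.lookup v p) 0 * res_aug F p)"

definition graded_free_resolution ::
  "('n monom \<Rightarrow> 'g::comm_monoid_add) \<Rightarrow> ('g, 'n, 'k::field) free_complex \<Rightarrow> bool" where
  "graded_free_resolution deg F \<longleftrightarrow>
     \<comment> \<open>the maps preserve degrees\<close>
     (\<forall>i. \<forall>p<res_rank F (Suc i). \<forall>q<res_rank F i. \<forall>m\<in>Poly_Mapping.keys (res_mat F i p q).
        deg m + res_shift F i q = res_shift F (Suc i) p) \<and>
     (\<forall>p<res_rank F 0. res_aug F p \<noteq> 0 \<longrightarrow> res_shift F 0 p = 0) \<and>
     \<comment> \<open>exactness\<close>
     res_augment F ` vecs UNIV (res_rank F 0) = UNIV \<and>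
     {v \<in> vecs UNIV (res_rank F 0). res_augment F v = 0}
       = res_diff F 0 ` vecs UNIV (res_rank F 1) \<and>
     (\<forall>i. {v \<in> vecs UNIV (res_rank F (Suc i)). res_diff F i v = 0}
       = res_diff F (Suc i) ` vecs UNIV (res_rank F (Suc (Suc i))))"

section \<open>Tor and graded Betti numbers\<close>

text \<open>The degree \<open>j\<close> part of \<open>F\<^sub>i \<otimes>\<^sub>R L\<close>.\<close>

definition graded_part ::
  "('n monom \<Rightarrow> 'g::comm_monoid_add) \<Rightarrow> ('g, 'n, 'k::field) free_complex \<Rightarrow>
     ('n, 'k) polyring set \<Rightarrow> nat \<Rightarrow> 'g \<Rightarrow> (nat \<Rightarrow>\<^sub>0 ('n, 'k) polyring) set" where
  "graded_part deg F L i j =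
     {v \<in> vecs L (res_rank F i).
        \<forall>p<res_rank F i. \<forall>m\<in>Poly_Mapping.keys (Poly_Mapping.lookup v p).
          deg m + res_shift F i p = j}"

text \<open>\<open>F\<^sub>0 \<otimes> L\<close> is the last module of the complex \<open>F \<otimes> L\<close>: the augmentation is dropped.\<close>

definition tor_cycles ::
  "('n monom \<Rightarrow> 'g::comm_monoid_add) \<Rightarrow> ('g, 'n, 'k::field) free_complex \<Rightarrow>
     ('n, 'k) polyring set \<Rightarrow> nat \<Rightarrow> 'g \<Rightarrow> (nat \<Rightarrow>\<^sub>0 ('n, 'k) polyring) set" where
  "tor_cycles deg F L i j =
     (case i of
        0 \<Rightarrow> graded_part deg F L 0 j
      | Suc i' \<Rightarrow> {v \<in> graded_part deg F L (Suc i') j. res_diff F i' v = 0})"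

definition tor_boundaries ::
  "('n monom \<Rightarrow> 'g::comm_monoid_add) \<Rightarrow> ('g, 'n, 'k::field) free_complex \<Rightarrow>
     ('n, 'k) polyring set \<Rightarrow> nat \<Rightarrow> 'g \<Rightarrow> (nat \<Rightarrow>\<^sub>0 ('n, 'k) polyring) set" where
  "tor_boundaries deg F L i j = res_diff F i ` graded_part deg F L (Suc i) j"

definition kscale ::
  "'k::field \<Rightarrow> (nat \<Rightarrow>\<^sub>0 ('n, 'k) polyring) \<Rightarrow> (nat \<Rightarrow>\<^sub>0 ('n, 'k) polyring)" where
  "kscale c v = Poly_Mapping.map (\<lambda>f. Poly_Mapping.single 0 c * f) v"

text \<open>
  The \<open>k\<close>-dimension of the quotient space \<open>Z / B\<close> (intended for \<open>Z / B\<close> finite-dimensional):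
  the number of elements of a set \<open>S \<subseteq> Z\<close> whose cosets are distinct and form a basis of
  \<open>Z / B\<close>.
\<close>

definition quotient_dim ::
  "(nat \<Rightarrow>\<^sub>0 ('n, 'k::field) polyring) set \<Rightarrow> (nat \<Rightarrow>\<^sub>0 ('n, 'k) polyring) set \<Rightarrow> nat" where
  "quotient_dim Z B =
     (THE d. \<exists>S \<subseteq> Z. finite S \<and> card S = d \<and>
        (\<forall>c. (\<Sum>s\<in>S. kscale (c s) s) \<in> B \<longrightarrow> (\<forall>s\<in>S. c s = 0)) \<and>
        (\<forall>z\<in>Z. \<exists>c. z - (\<Sum>s\<in>S. kscale (c s) s) \<in> B))"

text \<open>
  \<open>\<beta>\<^sub>i\<^sub>,\<^sub>j(L) = dim\<^sub>k Tor\<^sub>i(k, L)\<^sub>j\<close>, where \<open>Tor\<^sub>i(k, L)\<close> is the \<open>i\<close>-th homology of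
  \<open>F \<otimes> L\<close> for a graded free resolution \<open>F\<close> of \<open>k\<close> by modules of finite rank. One such
  \<open>F\<close> is chosen for each grading; up to isomorphism, Tor does not depend on this choice.
\<close>

definition betti ::
  "('n monom \<Rightarrow> 'g::comm_monoid_add) \<Rightarrow> int \<Rightarrow> 'g \<Rightarrow> ('n, 'k::field) polyring set \<Rightarrow> nat" where
  "betti deg i j L =
     (if i < 0 then 0
      else let F = (SOME F. graded_free_resolution deg F)
           in quotient_dim (tor_cycles deg F L (nat i) j) (tor_boundaries deg F L (nat i) j))"

definition betti_splitting ::
  "('n monom \<Rightarrow> 'g::comm_monoid_add) \<Rightarrow> ('n, 'k::field) polyring set \<Rightarrow>
     ('n, 'k) polyring set \<Rightarrow> ('n, 'k) polyring set \<Rightarrow> bool" where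
  "betti_splitting deg I J K \<longleftrightarrow>
     min_gens I = min_gens J \<union> min_gens K \<and> min_gens J \<inter> min_gens K = {} \<and>
     (\<forall>(i::nat) j. betti deg (int i) j I =
        betti deg (int i) j J + betti deg (int i) j K + betti deg (int i - 1) j (J \<inter> K))"

end

theory Submission
  imports Defs "HOL.Vector_Spaces" "HOL-Library.FuncSet"
begin

text \<open>
  Fix a degree \<open>j\<close> and a free resolution \<open>F\<close> of \<open>k\<close>, and let \<open>Z\<^sub>i(L)\<close> and \<open>B\<^sub>i(L)\<close> be the cycles and
  boundaries of \<open>F \<otimes> L\<close> in degree \<open>j\<close>. The hypothesis says exactly what is needed for
  \<open>B\<^sub>i(J) \<inter> B\<^sub>i(K) = Z\<^sub>i(J \<inter> K)\<close>: either the right-hand side consists of boundaries of \<open>J \<inter> K\<close>, or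
  all cycles of \<open>J\<close> and of \<open>K\<close> are boundaries. Since \<open>B\<^sub>i(I) = B\<^sub>i(J) + B\<^sub>i(K)\<close>, this determines
  \<open>dim B\<^sub>i(I)\<close>. The chains satisfy \<open>C\<^sub>i(I) = C\<^sub>i(J) + C\<^sub>i(K)\<close> and \<open>C\<^sub>i(J \<inter> K) = C\<^sub>i(J) \<inter> C\<^sub>i(K)\<close>, so
  rank-nullity yields \<open>dim Z\<^sub>i(I)\<close> and the formula drops out, with no connecting homomorphism.

  As Tor is computed from a chosen resolution, one has to exist for the choice to be meaningful.
  It arises by adjoining the variables one at a time: the mapping cone of multiplication by \<open>x\<close> on
  a resolution of \<open>R / (V)\<close> resolves \<open>R / (V, x)\<close>, because \<open>x\<close> is a nonzerodivisor modulo the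
  ideal generated by the other variables \<open>V\<close>.
\<close>

section \<open>Dimensions of quotient spaces\<close>

context vector_space begin

text \<open>This is the condition inside \<open>quotient_dim\<close>, stated over an arbitrary
  vector space. Coefficients are total functions on vectors, of which only the values on
  \<open>S\<close> count.\<close>

definition quotient_basis :: "'b set \<Rightarrow> 'b set \<Rightarrow> 'b set \<Rightarrow> bool" where
  "quotient_basis S Z B \<longleftrightarrow> S \<subseteq> Z \<and> finite S \<and>
     (\<forall>c. (\<Sum>s\<in>S. c s *s s) \<in> B \<longrightarrow> (\<forall>s\<in>S. c s = 0)) \<and>
     (\<forall>z\<in>Z. \<exists>c. z - (\<Sum>s\<in>S. c s *s s) \<in> B)"

text \<open>Finite dimensionality is expressed throughout as containment in the span of a finite set
  \<open>T\<close>; without such a bound \<open>dim\<close> could be a meaningless 0.\<close>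

lemma finite_basis_exists:
  assumes "finite T" "B \<subseteq> span T"
  obtains C where "C \<subseteq> B" "independent C" "finite C" "B \<subseteq> span C" "card C = dim B"
proof -
  obtain C where C: "C \<subseteq> B" "independent C" "B \<subseteq> span C"
    using maximal_independent_subset by blast
  moreover from C assms have "finite C"
    using independent_span_bound[of T C] by blast
  ultimately show ?thesis using that basis_card_eq_dim by blast
qed

text \<open>A quotient basis joined with a basis of \<open>B\<close> is a basis of \<open>Z\<close>.
  Hence all quotient bases have the same size.\<close>

lemma card_quotient_basis:
  assumes Z: "subspace Z" "Z \<subseteq> span T" "finite T" and B: "subspace B" "B \<subseteq> Z"
    and S: "quotient_basis S Z B"
  shows "card S + dim B = dim Z"
proof -
  obtain C where C: "C \<subseteq> B" "independent C" "finite C" "B \<subseteq> span C" "card C = dim B"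
    using finite_basis_exists[OF \<open>finite T\<close> subset_trans[OF B(2) \<open>Z \<subseteq> span T\<close>]] by metis
  have sc: "span C = B" using C B(1) span_minimal by blast
  have fS: "finite S" and SZ: "S \<subseteq> Z"
    and ind: "\<And>c s. (\<Sum>s\<in>S. c s *s s) \<in> B \<Longrightarrow> s \<in> S \<Longrightarrow> c s = 0"
    and spn: "\<And>z. z \<in> Z \<Longrightarrow> \<exists>c. z - (\<Sum>s\<in>S. c s *s s) \<in> B"
    using S unfolding quotient_basis_def by blast+
  \<comment> \<open>Unit coefficients at \<open>s\<close> would give a combination in
    \<open>B\<close> that is not trivial.\<close>
  have disj: "s \<notin> B" if "s \<in> S" for s
  proof
    assume "s \<in> B"
    moreover have "(\<Sum>t\<in>S. (if t = s then 1 else 0) *s t) = (\<Sum>t\<in>S. if t = s then t else 0)"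
      by (intro sum.cong) auto
    ultimately have "(\<Sum>t\<in>S. (if t = s then 1 else 0) *s t) \<in> B"
      using fS that by simp
    from ind[OF this that] show False by simp
  qed
  have SC: "S \<inter> C = {}" using disj C(1) by blast
  have "independent (S \<union> C)"
  proof (rule independent_if_scalars_zero)
    show "finite (S \<union> C)" using fS C by simp
    fix u x assume 0: "(\<Sum>x\<in>S \<union> C. u x *s x) = 0" and x: "x \<in> S \<union> C"
    have split: "(\<Sum>x\<in>S. u x *s x) + (\<Sum>x\<in>C. u x *s x) = 0"
      using 0 sum.union_disjoint[OF fS C(3) SC] by metis
    have "(\<Sum>x\<in>C. u x *s x) \<in> B"
      using C(1) B(1) by (auto intro!: subspace_sum subspace_scale)
    hence "(\<Sum>x\<in>S. u x *s x) \<in> B"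
      using split B(1) by (metis add_eq_0_iff2 subspace_neg)
    hence S0: "\<forall>s\<in>S. u s = 0" using ind by blast
    hence "(\<Sum>x\<in>C. u x *s x) = 0" using split by simp
    hence "\<forall>x\<in>C. u x = 0" using independentD[OF C(2,3) subset_refl] by blast
    with S0 x show "u x = 0" by blast
  qed
  moreover have "Z \<subseteq> span (S \<union> C)"
  proof
    fix z assume "z \<in> Z"
    then obtain c where "z - (\<Sum>s\<in>S. c s *s s) \<in> B" using spn by blast
    hence "z - (\<Sum>s\<in>S. c s *s s) \<in> span (S \<union> C)"
      using sc span_mono[of C "S \<union> C"] by blast
    moreover have "(\<Sum>s\<in>S. c s *s s) \<in> span (S \<union> C)"
      by (intro span_sum span_scale span_base) auto
    ultimately show "z \<in> span (S \<union> C)" by (metis span_add diff_add_cancel)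
  qed
  moreover have "S \<union> C \<subseteq> Z" using SZ C(1) B(2) by blast
  ultimately have "card (S \<union> C) = dim Z" by (intro basis_card_eq_dim)
  thus ?thesis using card_Un_disjoint[OF fS C(3) SC] C(5) by simp
qed

text \<open>Extend a basis \<open>C\<close> of \<open>B\<close> to a basis \<open>D\<close> of
  \<open>Z\<close>; the added vectors \<open>D - C\<close> represent a basis of the
  quotient.\<close>

lemma quotient_basis_exists:
  assumes Z: "Z \<subseteq> span T" "finite T" and B: "subspace B" "B \<subseteq> Z"
  obtains S where "quotient_basis S Z B"
proof -
  obtain C where C: "C \<subseteq> B" "independent C" "finite C" "B \<subseteq> span C"
    using finite_basis_exists[OF \<open>finite T\<close> subset_trans[OF B(2) \<open>Z \<subseteq> span T\<close>]] by metis
  have sc: "span C = B" using C B(1) span_minimal by blast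
  have "C \<subseteq> Z" using C B by blast
  then obtain D where D: "C \<subseteq> D" "D \<subseteq> Z" "independent D" "Z \<subseteq> span D"
    using maximal_independent_subset_extend[OF _ C(2)] by metis
  have fD: "finite D" using independent_span_bound[OF Z(2) D(3)] D(2) Z(1) by blast
  have split: "(\<Sum>x\<in>D. u x *s x) = (\<Sum>x\<in>D - C. u x *s x) + (\<Sum>x\<in>C. u x *s x)" for u
    using sum.subset_diff[OF D(1) fD] by blast
  have "quotient_basis (D - C) Z B" unfolding quotient_basis_def
  proof (intro conjI allI impI ballI)
    fix c s assume cB: "(\<Sum>s\<in>D - C. c s *s s) \<in> B" and s: "s \<in> D - C"
    then obtain u where u: "(\<Sum>s\<in>D - C. c s *s s) = (\<Sum>x\<in>C. u x *s x)"
      using sc span_finite[OF C(3)] by auto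
    \<comment> \<open>Moving the element of \<open>B\<close>, written in terms of \<open>C\<close>,
      to the other side turns the relation modulo \<open>B\<close> into a genuine relation on
      \<open>D\<close>.\<close>
    let ?w = "\<lambda>x. if x \<in> C then - u x else c x"
    have "(\<Sum>x\<in>D. ?w x *s x) = (\<Sum>x\<in>D - C. c x *s x) + (\<Sum>x\<in>C. (- u x) *s x)"
      unfolding split by (intro arg_cong2[where f = "(+)"] sum.cong) auto
    also have "\<dots> = 0" using u by (simp add: sum_negf)
    finally have "?w s = 0" using s by (intro independentD[OF D(3) fD subset_refl, of ?w]) auto
    thus "c s = 0" using s by auto
  next
    fix z assume "z \<in> Z"
    then obtain u where "z = (\<Sum>x\<in>D. u x *s x)"
      using D(4) span_finite[OF fD] by auto
    hence "z - (\<Sum>x\<in>D - C. u x *s x) = (\<Sum>x\<in>C. u x *s x)" by (simp add: split)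
    also have "\<dots> \<in> B"
      using C(1) B(1) by (auto intro!: subspace_sum subspace_scale)
    finally show "\<exists>c. z - (\<Sum>s\<in>D - C. c s *s s) \<in> B" by blast
  qed (use D fD in auto)
  thus ?thesis by (rule that)
qed

text \<open>By the second isomorphism theorem, a quotient basis of \<open>A\<close> modulo
  \<open>A \<inter> B\<close> is also one of \<open>A + B\<close> modulo \<open>B\<close>; its size
  is then counted in both ways.\<close>

lemma dim_sum_Int:
  assumes A: "subspace A" "A \<subseteq> span T" and B: "subspace B" "B \<subseteq> span T" and T: "finite T"
  shows "dim {x + y |x y. x \<in> A \<and> y \<in> B} + dim (A \<inter> B) = dim A + dim B"
proof -
  let ?P = "{x + y |x y. x \<in> A \<and> y \<in> B}"
  obtain S where S: "quotient_basis S A (A \<inter> B)"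
    using quotient_basis_exists[OF A(2) T subspace_inter[OF A(1) B(1)] Int_lower1] .
  have P: "subspace ?P" "?P \<subseteq> span T"
    using A B by (auto intro: subspace_sums span_add)
  have AP: "A \<subseteq> ?P" and BP: "B \<subseteq> ?P"
  proof -
    show "A \<subseteq> ?P"
    proof
      fix a assume "a \<in> A"
      thus "a \<in> ?P" using subspace_0[OF B(1)] by force
    qed
    show "B \<subseteq> ?P"
    proof
      fix a assume "a \<in> B"
      thus "a \<in> ?P" using subspace_0[OF A(1)] by force
    qed
  qed
  have "quotient_basis S ?P B" unfolding quotient_basis_def
  proof (intro conjI ballI allI impI)
    show "S \<subseteq> ?P" "finite S" using S AP unfolding quotient_basis_def by blast+
  next
    fix c s assume c: "(\<Sum>s\<in>S. c s *s s) \<in> B" and s: "s \<in> S"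
    have "(\<Sum>s\<in>S. c s *s s) \<in> A"
      using S A(1) unfolding quotient_basis_def by (auto intro!: subspace_sum subspace_scale)
    thus "c s = 0" using S c s unfolding quotient_basis_def by blast
  next
    fix z assume "z \<in> ?P"
    then obtain x y where xy: "z = x + y" "x \<in> A" "y \<in> B" by blast
    then obtain c where "x - (\<Sum>s\<in>S. c s *s s) \<in> A \<inter> B"
      using S unfolding quotient_basis_def by blast
    hence "(x - (\<Sum>s\<in>S. c s *s s)) + y \<in> B" using xy B(1) by (auto intro: subspace_add)
    thus "\<exists>c. z - (\<Sum>s\<in>S. c s *s s) \<in> B" using xy(1) by (auto simp: algebra_simps)
  qed
  hence "card S + dim B = dim ?P" using card_quotient_basis[OF P T B(1) BP] by blast
  moreover have "card S + dim (A \<inter> B) = dim A"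
    using card_quotient_basis[OF A T _ _ S] A B subspace_inter by blast
  ultimately show ?thesis by simp
qed

text \<open>\<open>f\<close> maps a quotient basis of \<open>Z\<close> modulo the kernel injectively
  onto a basis of the image, treated as a quotient basis modulo \<open>{0}\<close>.\<close>

lemma dim_kernel_image:
  assumes f: "module_hom scale scale f"
    and Z: "subspace Z" "Z \<subseteq> span T" "finite T"
  shows "dim {x \<in> Z. f x = 0} + dim (f ` Z) = dim Z"
proof -
  interpret f: module_hom scale scale f by fact
  let ?N = "{x \<in> Z. f x = 0}"
  have N: "subspace ?N" "?N \<subseteq> Z"
    using Z(1) by (auto simp: subspace_def f.add f.scale)
  obtain S where S: "quotient_basis S Z ?N"
    using quotient_basis_exists[OF Z(2,3) N] .
  have SZ: "S \<subseteq> Z" and fS: "finite S"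
    and ind: "\<And>c s. (\<Sum>s\<in>S. c s *s s) \<in> ?N \<Longrightarrow> s \<in> S \<Longrightarrow> c s = 0"
    and spn: "\<And>z. z \<in> Z \<Longrightarrow> \<exists>c. z - (\<Sum>s\<in>S. c s *s s) \<in> ?N"
    using S unfolding quotient_basis_def by blast+
  have fsum: "f (\<Sum>s\<in>S. c s *s s) = (\<Sum>s\<in>S. c s *s f s)" for c
    by (simp add: f.sum f.scale)
  have sumZ: "(\<Sum>s\<in>S. c s *s s) \<in> Z" for c
    using SZ Z(1) by (auto intro!: subspace_sum subspace_scale)
  have inj: "inj_on f S"
  proof (rule inj_onI, rule ccontr)
    fix s t assume st: "s \<in> S" "t \<in> S" "f s = f t" "s \<noteq> t"
    \<comment> \<open>These coefficients represent \<open>s - t\<close>, which would lie in the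
      kernel.\<close>
    let ?c = "\<lambda>x. if x = s then 1 else if x = t then - 1 else 0"
    have "(\<Sum>x\<in>S. ?c x *s f x) = (\<Sum>x\<in>{s,t}. ?c x *s f x)"
      using fS st by (intro sum.mono_neutral_right) auto
    also have "\<dots> = 0" using st by simp
    finally have "(\<Sum>x\<in>S. ?c x *s x) \<in> ?N" using sumZ fsum[of ?c] by auto
    from ind[OF this st(1)] show False by simp
  qed
  have "quotient_basis (f ` S) (f ` Z) {0}" unfolding quotient_basis_def
  proof (intro conjI ballI allI impI)
    show "f ` S \<subseteq> f ` Z" "finite (f ` S)" using SZ fS by auto
  next
    fix c s assume "(\<Sum>s\<in>f ` S. c s *s s) \<in> {0}" and s: "s \<in> f ` S"
    hence "f (\<Sum>s\<in>S. c (f s) *s s) = 0" using inj by (simp add: sum.reindex fsum)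
    hence "(\<Sum>s\<in>S. c (f s) *s s) \<in> ?N" using sumZ[of "\<lambda>s. c (f s)"] by simp
    from ind[OF this] s show "c s = 0" by blast
  next
    fix z assume "z \<in> f ` Z"
    then obtain x where x: "z = f x" "x \<in> Z" by blast
    then obtain c where "x - (\<Sum>s\<in>S. c s *s s) \<in> ?N" using spn by blast
    hence "z = (\<Sum>s\<in>S. c s *s f s)" using x by (simp add: f.diff fsum)
    also have "\<dots> = (\<Sum>s\<in>f ` S. c (inv_into S f s) *s s)"
      using inj by (simp add: sum.reindex)
    finally show "\<exists>c. z - (\<Sum>s\<in>f ` S. c s *s s) \<in> {0}" by auto
  qed
  moreover have "subspace (f ` Z)" using Z(1) by (rule f.subspace_image)
  moreover have "f ` Z \<subseteq> span (f ` T)" using Z(2) f.span_image by blast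
  moreover have "subspace {0}" "{0} \<subseteq> f ` Z"
    using subspace_0[OF \<open>subspace (f ` Z)\<close>] by (auto simp: subspace_def)
  ultimately have "card (f ` S) + dim {0} = dim (f ` Z)"
    using Z(3) by (intro card_quotient_basis[where T = "f ` T"]) auto
  moreover have "dim {0} = 0" using dim_eq_card_independent[of "{}"] dim_span[of "{}"]
    by (simp add: independent_empty)
  moreover have "card S + dim ?N = dim Z" using card_quotient_basis[OF Z N S] .
  ultimately show ?thesis using card_image[OF inj] by simp
qed

end

section \<open>Exponents of monomial ideals\<close>

definition upward_closure :: "'n monom set \<Rightarrow> 'n monom set" where
  "upward_closure A = {a + c |a c. a \<in> A}"

definition upward_closed :: "'n monom set \<Rightarrow> bool" where
  "upward_closed U \<longleftrightarrow> (\<forall>m\<in>U. \<forall>c. m + c \<in> U)"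

text \<open>Divisibility of monomials is addition of exponents, so these exponents are minimal under
  divisibility.\<close>

definition minimal_exps :: "'n monom set \<Rightarrow> 'n monom set" where
  "minimal_exps U = {m \<in> U. \<forall>a\<in>U. \<forall>c. m = a + c \<longrightarrow> c = 0}"

lemma module_times: "module ((*) :: 'a::comm_ring_1 \<Rightarrow> 'a \<Rightarrow> 'a)"
  by unfold_locales (auto simp: algebra_simps)

lemma poly_mapping_sum_single: "f = (\<Sum>m\<in>Poly_Mapping.keys f. Poly_Mapping.single m (Poly_Mapping.lookup f m))"
  by (rule poly_mapping_eqI) (simp add: lookup_sum lookup_single when_def in_keys_iff)

text \<open>A polynomial lies in a monomial ideal iff each of its terms is a multiple of a
  generator: the right-hand side is an ideal containing the generators, and its elements are sums of
  such terms.\<close>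

lemma ideal_gen_monomials:
  fixes A :: "'n monom set"
  shows "ideal_gen ((\<lambda>m. Poly_Mapping.single m 1) ` A)
    = {f :: ('n, 'k::field) polyring. Poly_Mapping.keys f \<subseteq> upward_closure A}" (is "?L = ?R")
proof
  interpret R: module "(*) :: ('n, 'k) polyring \<Rightarrow> _" by (rule module_times)
  show "?L \<subseteq> ?R" unfolding ideal_gen_def
  proof (rule R.span_minimal)
    show "(\<lambda>m. Poly_Mapping.single m 1) ` A \<subseteq> ?R"
      by (force simp: upward_closure_def intro: exI[of _ 0])
    show "R.subspace ?R" unfolding R.subspace_def
    proof (intro conjI ballI allI)
      fix f g :: "('n, 'k) polyring" assume "f \<in> ?R" "g \<in> ?R"
      thus "f + g \<in> ?R" using keys_add[of f g] by blast
    next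
      fix f g :: "('n, 'k) polyring" assume g: "g \<in> ?R"
      have "a + b \<in> upward_closure A" if "b \<in> Poly_Mapping.keys g" for a b
      proof -
        from g that obtain m c where "m \<in> A" "b = m + c" by (auto simp: upward_closure_def)
        hence "a + b = m + (a + c)" by (simp add: algebra_simps)
        thus ?thesis unfolding upward_closure_def using \<open>m \<in> A\<close> by blast
      qed
      thus "f * g \<in> ?R" using keys_mult[of f g] by blast
    qed simp
  qed
  show "?R \<subseteq> ?L"
  proof
    fix f assume f: "f \<in> ?R"
    have "Poly_Mapping.single m (Poly_Mapping.lookup f m) \<in> ?L" if m: "m \<in> Poly_Mapping.keys f" for m
    proof -
      obtain a c where ac: "a \<in> A" "m = a + c" using f m by (auto simp: upward_closure_def)
      have "Poly_Mapping.single m (Poly_Mapping.lookup f m)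
          = Poly_Mapping.single c (Poly_Mapping.lookup f m) * Poly_Mapping.single a 1"
        by (simp add: mult_single ac add.commute)
      also have "\<dots> \<in> ?L"
        unfolding ideal_gen_def using ac(1) by (intro R.span_scale R.span_base imageI)
      finally show ?thesis .
    qed
    hence "(\<Sum>m\<in>Poly_Mapping.keys f. Poly_Mapping.single m (Poly_Mapping.lookup f m)) \<in> ?L"
      unfolding ideal_gen_def by (intro R.span_sum) auto
    thus "f \<in> ?L" using poly_mapping_sum_single[of f] by metis
  qed
qed

lemma upward_closed_closure: "upward_closed (upward_closure A)"
  by (auto simp: upward_closure_def upward_closed_def) (metis add.assoc)

lemma upward_closure_subset: "A \<subseteq> upward_closure A"
  by (force simp: upward_closure_def intro: exI[of _ 0])

lemma ideal_gen_monomials_eq_iff: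
  "ideal_gen ((\<lambda>m. Poly_Mapping.single m 1) ` A)
      = (ideal_gen ((\<lambda>m. Poly_Mapping.single m 1) ` B) :: ('n, 'k::field) polyring set)
    \<longleftrightarrow> upward_closure A = upward_closure B" (is "?L = ?R \<longleftrightarrow> _")
proof
  have *: "(Poly_Mapping.single m 1 :: ('n, 'k) polyring)
      \<in> ideal_gen ((\<lambda>m. Poly_Mapping.single m 1) ` A) \<longleftrightarrow> m \<in> upward_closure A"
    for A and m :: "'n monom"
    by (simp add: ideal_gen_monomials)
  assume "?L = ?R"
  thus "upward_closure A = upward_closure B" using *[of _ A] *[of _ B] by auto
qed (simp add: ideal_gen_monomials)

lemma std_degree_add: "std_degree (a + c) = std_degree a + std_degree c"
  by (simp add: std_degree_def lookup_add sum.distrib)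

lemma std_degree_eq_0_iff: "std_degree c = 0 \<longleftrightarrow> c = 0"
  by (auto simp: std_degree_def intro!: poly_mapping_eqI)

text \<open>A proper divisor has smaller total degree, so descending to divisors inside
  \<open>U\<close> must stop.\<close>

lemma minimal_exps_below:
  fixes m :: "'n::finite monom"
  assumes "m \<in> U"
  shows "\<exists>a\<in>minimal_exps U. \<exists>c. m = a + c"
  using assms
proof (induction "std_degree m" arbitrary: m rule: less_induct)
  case less
  show ?case
  proof (cases "m \<in> minimal_exps U")
    case True
    thus ?thesis by (intro bexI[of _ m] exI[of _ 0]) auto
  next
    case False
    then obtain a c where ac: "a \<in> U" "m = a + c" "c \<noteq> 0"
      using less.prems by (auto simp: minimal_exps_def)
    hence "std_degree a < std_degree m"
      using std_degree_eq_0_iff[of c] by (simp add: std_degree_add)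
    then obtain b d where "b \<in> minimal_exps U" "a = b + d" using less.hyps ac(1) by blast
    thus ?thesis using ac(2) by (intro bexI[of _ b] exI[of _ "d + c"]) (auto simp: add.assoc)
  qed
qed

lemma upward_closure_minimal_exps:
  fixes A :: "'n::finite monom set"
  shows "upward_closure (minimal_exps (upward_closure A)) = upward_closure A" (is "?l = ?r")
proof
  show "?l \<subseteq> ?r"
  proof
    fix m assume "m \<in> ?l"
    then obtain a c where "a \<in> upward_closure A" "m = a + c"
      unfolding upward_closure_def[of "minimal_exps _"] by (auto simp: minimal_exps_def)
    thus "m \<in> ?r" by (auto simp: upward_closure_def) (metis add.assoc)
  qed
  show "?r \<subseteq> ?l"
    using minimal_exps_below[of _ "upward_closure A"]
    unfolding upward_closure_def[of "minimal_exps _"] by blast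
qed

text \<open>A minimal exponent is a multiple of some generator, hence equal to it. Uniqueness of the
  minimal generating set rests on this.\<close>

lemma minimal_exps_subset_generators:
  assumes "upward_closure B = U"
  shows "minimal_exps U \<subseteq> B"
proof
  fix m assume m: "m \<in> minimal_exps U"
  then obtain b c where "b \<in> B" "m = b + c"
    using assms by (auto simp: minimal_exps_def upward_closure_def)
  moreover from this have "b \<in> U" using assms upward_closure_subset[of B] by blast
  ultimately show "m \<in> B" using m by (auto simp: minimal_exps_def)
qed

section \<open>Minimal generators of monomial ideals\<close>

lemma monomials_eq_image: "monomials = range (\<lambda>m. Poly_Mapping.single m 1)"
  by (auto simp: monomials_def)

text \<open>\<open>min_gens\<close> is a definite description, so existence and uniqueness come
  first. The monomials with exponents in \<open>minimal_exps U\<close> generate \<open>L\<close> and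
  lie in every set of monomials generating \<open>L\<close>; a minimal such set must therefore equal
  them.\<close>

lemma min_gens_generate:
  fixes L :: "('n::finite, 'k::field) polyring set"
  assumes "monomial_ideal L"
  shows "min_gens L \<subseteq> monomials" and "ideal_gen (min_gens L) = L"
proof -
  let ?mon = "\<lambda>m. Poly_Mapping.single m 1 :: ('n, 'k) polyring"
  have monoms: "M \<subseteq> monomials \<longleftrightarrow> (\<exists>A. M = ?mon ` A)" for M
    unfolding monomials_eq_image subset_image_iff by simp
  obtain M where M: "M \<subseteq> monomials" "L = ideal_gen M"
    using assms unfolding monomial_ideal_def by auto
  then obtain A where A: "L = ideal_gen (?mon ` A)" using monoms by metis
  define U where "U = upward_closure A"
  have gen: "ideal_gen (?mon ` B) = L \<longleftrightarrow> upward_closure B = U" for B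
    unfolding A U_def by (rule ideal_gen_monomials_eq_iff)
  have clU: "upward_closure (minimal_exps U) = U"
    unfolding U_def by (rule upward_closure_minimal_exps)
  let ?P = "\<lambda>G. G \<subseteq> monomials \<and> ideal_gen G = L \<and> (\<forall>H. H \<subset> G \<longrightarrow> ideal_gen H \<noteq> L)"
  have "?P (?mon ` minimal_exps U)"
  proof (intro conjI allI impI notI)
    show "?mon ` minimal_exps U \<subseteq> monomials" using monoms by blast
    show "ideal_gen (?mon ` minimal_exps U) = L" using gen clU by blast
  next
    fix H assume H: "H \<subset> ?mon ` minimal_exps U" "ideal_gen H = L"
    then obtain B where B: "H = ?mon ` B" by (meson psubset_imp_subset subset_image_iff)
    hence "minimal_exps U \<subseteq> B" using gen[of B] H(2) minimal_exps_subset_generators by metis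
    thus False using H(1) B by blast
  qed
  moreover have "G = ?mon ` minimal_exps U" if G: "?P G" for G
  proof -
    obtain B where B: "G = ?mon ` B" using G monoms[of G] by metis
    hence "?mon ` minimal_exps U \<subseteq> G"
      using gen[of B] G minimal_exps_subset_generators by (metis image_mono)
    moreover have "ideal_gen (?mon ` minimal_exps U) = L" using gen clU by blast
    ultimately show ?thesis using G psubsetI by metis
  qed
  ultimately have "?P (min_gens L)" unfolding min_gens_def by (rule theI)
  thus "min_gens L \<subseteq> monomials" "ideal_gen (min_gens L) = L" by blast+
qed

text \<open>Monomial ideals are the sets of this form with \<open>U\<close> upward closed. Sums and
  intersections of ideals become unions and intersections of exponent sets.\<close>

definition supported_on :: "'n monom set \<Rightarrow> ('n, 'k::field) polyring set" where
  "supported_on U = {f. Poly_Mapping.keys f \<subseteq> U}"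

text \<open>Here the hypothesis on minimal generators turns into \<open>I = J + K\<close>, read on
  exponent sets as a union.\<close>

lemma monomial_ideal_sum_exps:
  fixes I J K :: "('n::finite, 'k::field) polyring set"
  assumes "monomial_ideal I" "monomial_ideal J" "monomial_ideal K"
    and G: "min_gens I = min_gens J \<union> min_gens K"
  obtains U V where "upward_closed U" "upward_closed V"
    "J = supported_on U" "K = supported_on V"
    "I = supported_on (U \<union> V)"
proof -
  let ?mon = "\<lambda>m. Poly_Mapping.single m 1 :: ('n, 'k) polyring"
  obtain A B where AB: "min_gens J = ?mon ` A" "min_gens K = ?mon ` B"
    using min_gens_generate(1) assms(2,3) unfolding monomials_eq_image by (metis subset_image_iff)
  have "J = {f. Poly_Mapping.keys f \<subseteq> upward_closure A}"
    using min_gens_generate(2)[OF assms(2)] unfolding AB ideal_gen_monomials by simp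
  moreover have "K = {f. Poly_Mapping.keys f \<subseteq> upward_closure B}"
    using min_gens_generate(2)[OF assms(3)] unfolding AB ideal_gen_monomials by simp
  moreover have "I = {f. Poly_Mapping.keys f \<subseteq> upward_closure (A \<union> B)}"
    using min_gens_generate(2)[OF assms(1)]
    unfolding G AB image_Un[symmetric] ideal_gen_monomials by simp
  moreover have "upward_closure (A \<union> B) = upward_closure A \<union> upward_closure B"
    by (auto simp: upward_closure_def)
  ultimately show ?thesis
    using that[OF upward_closed_closure upward_closed_closure, of A B] by (simp add: supported_on_def)
qed

section \<open>A free resolution of the residue field\<close>

text \<open>The differential in coordinates. Letting \<open>v\<close> be any function, with values
  beyond the rank ignored, avoids carrying support conditions through the construction.\<close>

definition mat_diff ::
  "('g, 'n, 'k::field) free_complex \<Rightarrow> nat \<Rightarrow> (nat \<Rightarrow> ('n, 'k) polyring) \<Rightarrow> nat \<Rightarrow> ('n, 'k) polyring" where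
  "mat_diff F i v q = (\<Sum>p<res_rank F (Suc i). v p * res_mat F i p q)"

text \<open>The ideal generated by the variables in \<open>V\<close>, described through its
  monomials.\<close>

definition variable_ideal :: "'n set \<Rightarrow> ('n, 'k::field) polyring set" where
  "variable_ideal V = {f. \<forall>m\<in>Poly_Mapping.keys f. \<exists>v\<in>V. Poly_Mapping.lookup m v > 0}"

text \<open>A resolution of \<open>R / (V)\<close> with \<open>R\<close> in position 0. Exactness at
  that end is recorded as the image of the first differential, because for general \<open>V\<close>
  the quotient is not the field \<open>k\<close>.\<close>

definition resolves_variable_ideal ::
  "('n monom \<Rightarrow> 'g::comm_monoid_add) \<Rightarrow> 'n set \<Rightarrow> ('g, 'n, 'k::field) free_complex \<Rightarrow> bool" where
  "resolves_variable_ideal deg V F \<longleftrightarrow>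
     res_rank F 0 = 1 \<and> res_shift F 0 0 = 0 \<and> res_aug F = (\<lambda>_. 1) \<and>
     (\<forall>i. \<forall>p<res_rank F (Suc i). \<forall>q<res_rank F i. \<forall>m\<in>Poly_Mapping.keys (res_mat F i p q).
        deg m + res_shift F i q = res_shift F (Suc i) p) \<and>
     (\<forall>i v. \<forall>q<res_rank F i. mat_diff F i (mat_diff F (Suc i) v) q = 0) \<and>
     (\<forall>i v. (\<forall>q<res_rank F i. mat_diff F i v q = 0) \<longrightarrow>
        (\<exists>w. \<forall>p<res_rank F (Suc i). v p = mat_diff F (Suc i) w p)) \<and>
     {mat_diff F 0 w 0 |w. True} = variable_ideal V"

lemma mat_diff_cong:
  "(\<And>p. p < res_rank F (Suc i) \<Longrightarrow> v p = w p) \<Longrightarrow> mat_diff F i v q = mat_diff F i w q"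
  unfolding mat_diff_def by (intro sum.cong) auto

lemma mat_diff_add: "mat_diff F i (\<lambda>p. v p + w p) q = mat_diff F i v q + mat_diff F i w q"
  unfolding mat_diff_def by (simp add: distrib_right sum.distrib)

lemma mat_diff_mult: "mat_diff F i (\<lambda>p. v p * c) q = mat_diff F i v q * c"
  unfolding mat_diff_def sum_distrib_right by (intro sum.cong) (simp_all add: mult_ac)

section \<open>Ideals generated by variables\<close>

lemma lookup_times_single:
  fixes f :: "('n, 'k::field) polyring"
  shows "Poly_Mapping.lookup (f * Poly_Mapping.single e c) (m + e) = Poly_Mapping.lookup f m * c"
proof -
  have "f * Poly_Mapping.single e c = (\<Sum>a\<in>Poly_Mapping.keys f.
      Poly_Mapping.single (a + e) (Poly_Mapping.lookup f a * c))"
    by (subst poly_mapping_sum_single[of f]) (simp add: sum_distrib_right mult_single)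
  thus ?thesis by (simp add: lookup_sum lookup_single when_def in_keys_iff)
qed

text \<open>Multiplying by \<open>x\<close> leaves the exponents of the variables in
  \<open>V\<close> unchanged, so \<open>x\<close> is a nonzerodivisor modulo
  \<open>(V)\<close>.\<close>

lemma variable_ideal_cancel:
  fixes f :: "('n, 'k::field) polyring"
  assumes "f * Poly_Mapping.single (Poly_Mapping.single x 1) 1 \<in> variable_ideal V" "x \<notin> V"
  shows "f \<in> variable_ideal V"
  unfolding variable_ideal_def mem_Collect_eq
proof
  let ?e = "Poly_Mapping.single x 1 :: 'n monom"
  fix m assume "m \<in> Poly_Mapping.keys f"
  hence "m + ?e \<in> Poly_Mapping.keys (f * Poly_Mapping.single ?e 1)"
    by (simp add: in_keys_iff lookup_times_single)
  then obtain v where "v \<in> V" "Poly_Mapping.lookup (m + ?e) v > 0"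
    using assms(1) unfolding variable_ideal_def by blast
  thus "\<exists>v\<in>V. Poly_Mapping.lookup m v > 0"
    using assms(2) by (intro bexI[of _ v]) (auto simp: lookup_add lookup_single when_def split: if_splits)
qed

lemma variable_ideal_times:
  fixes f :: "('n, 'k::field) polyring"
  shows "f * Poly_Mapping.single (Poly_Mapping.single x 1) 1 \<in> variable_ideal (insert x V)"
proof -
  have "Poly_Mapping.lookup m x > 0"
    if "m \<in> Poly_Mapping.keys (f * Poly_Mapping.single (Poly_Mapping.single x 1) 1)" for m
    using that keys_mult[of f "Poly_Mapping.single (Poly_Mapping.single x 1) 1"]
    by (auto simp: lookup_add split: if_splits)
  thus ?thesis by (auto simp: variable_ideal_def)
qed

lemma variable_ideal_add:
  "f \<in> variable_ideal V \<Longrightarrow> g \<in> variable_ideal V \<Longrightarrow> f + g \<in> variable_ideal V"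
  unfolding variable_ideal_def using keys_add[of f g] by blast

lemma variable_ideal_mono: "V \<subseteq> W \<Longrightarrow> variable_ideal V \<subseteq> variable_ideal W"
  unfolding variable_ideal_def by blast

text \<open>Terms divisible by a variable in \<open>V\<close> form \<open>g\<close>; every other
  term is divisible by \<open>x\<close>.\<close>

lemma variable_ideal_insert_decompose:
  fixes f :: "('n, 'k::field) polyring"
  assumes f: "f \<in> variable_ideal (insert x V)"
  obtains g h where "g \<in> variable_ideal V"
    "f = g + h * Poly_Mapping.single (Poly_Mapping.single x 1) 1"
proof -
  let ?e = "Poly_Mapping.single x 1 :: 'n monom"
  let ?A = "{m \<in> Poly_Mapping.keys f. \<exists>v\<in>V. Poly_Mapping.lookup m v > 0}"
  let ?s = "\<lambda>m. Poly_Mapping.single m (Poly_Mapping.lookup f m)"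
  let ?g = "\<Sum>m\<in>?A. ?s m"
  have "Poly_Mapping.keys ?g \<subseteq> ?A" using keys_sum[of ?s ?A] by (auto split: if_splits)
  hence "?g \<in> variable_ideal V" unfolding variable_ideal_def by blast
  moreover have "?s m = Poly_Mapping.single (m - ?e) (Poly_Mapping.lookup f m)
      * Poly_Mapping.single ?e 1" if "m \<in> Poly_Mapping.keys f - ?A" for m
  proof -
    have "Poly_Mapping.lookup m x > 0" using that f unfolding variable_ideal_def by blast
    \<comment> \<open>Subtraction of exponents is truncated; it is undone here because the exponent
      of \<open>x\<close> is positive.\<close>
    hence "m - ?e + ?e = m"
      by (intro poly_mapping_eqI) (auto simp: lookup_add lookup_minus lookup_single when_def)
    thus ?thesis by (simp add: mult_single)
  qed
  hence "(\<Sum>m\<in>Poly_Mapping.keys f - ?A. ?s m)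
      = (\<Sum>m\<in>Poly_Mapping.keys f - ?A. Poly_Mapping.single (m - ?e) (Poly_Mapping.lookup f m))
        * Poly_Mapping.single ?e 1"
    unfolding sum_distrib_right by (intro sum.cong) auto
  moreover have "f = (\<Sum>m\<in>Poly_Mapping.keys f - ?A. ?s m) + ?g"
    by (subst poly_mapping_sum_single[of f], rule sum.subset_diff) auto
  ultimately show ?thesis using that by (simp add: add.commute)
qed

text \<open>
  In position \<open>i\<close> the basis of \<open>F\<^sub>i\<close> is followed by that of \<open>F\<^sub>i\<^sub>-\<^sub>1\<close> (absent for \<open>i = 0\<close>, so that the
  truncated \<open>i - 1\<close> is harmless), and \<open>(a, b)\<close> is sent to \<open>(d a + (- 1)\<^sup>i x b, d b)\<close>.
\<close>

definition variable_cone ::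
  "('n monom \<Rightarrow> 'g::comm_monoid_add) \<Rightarrow> 'n \<Rightarrow> ('g, 'n, 'k::field) free_complex
    \<Rightarrow> ('g, 'n, 'k) free_complex" where
  "variable_cone deg x F = \<lparr>
     res_rank = (\<lambda>i. case i of 0 \<Rightarrow> res_rank F 0 | Suc i' \<Rightarrow> res_rank F (Suc i') + res_rank F i'),
     res_shift = (\<lambda>i p. if p < res_rank F i then res_shift F i p
        else res_shift F (i - 1) (p - res_rank F i) + deg (Poly_Mapping.single x 1)),
     res_mat = (\<lambda>i p q.
        if p < res_rank F (Suc i) then (if q < res_rank F i then res_mat F i p q else 0)
        else if q < res_rank F i
          then (if p - res_rank F (Suc i) = q
            then Poly_Mapping.single (Poly_Mapping.single x 1) ((- 1) ^ i) else 0)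
        else res_mat F (i - 1) (p - res_rank F (Suc i)) (q - res_rank F i)),
     res_aug = res_aug F\<rparr>"

lemma sum_lessThan_plus:
  fixes f :: "nat \<Rightarrow> 'a::comm_monoid_add"
  shows "(\<Sum>p<a + b. f p) = (\<Sum>p<a. f p) + (\<Sum>p<b. f (a + p))"
  by (induction b) (simp_all add: add.assoc)

lemma mat_diff_cone_low:
  assumes "q < res_rank F i"
  shows "mat_diff (variable_cone deg x F) i v q = mat_diff F i v q
    + v (res_rank F (Suc i) + q) * Poly_Mapping.single (Poly_Mapping.single x 1) ((- 1) ^ i)"
proof -
  have "(\<Sum>p<res_rank F i. v (res_rank F (Suc i) + p) * (if p = q
            then Poly_Mapping.single (Poly_Mapping.single x 1) ((- 1) ^ i) else 0))
      = (\<Sum>p<res_rank F i. if p = q then v (res_rank F (Suc i) + p)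
            * Poly_Mapping.single (Poly_Mapping.single x 1) ((- 1) ^ i) else 0)"
    by (intro sum.cong) auto
  thus ?thesis using assms
    by (simp add: mat_diff_def variable_cone_def sum_lessThan_plus)
qed

lemma mat_diff_cone_high:
  "q < res_rank F i \<Longrightarrow>
    mat_diff (variable_cone deg x F) (Suc i) v (res_rank F (Suc i) + q)
      = mat_diff F i (\<lambda>p. v (res_rank F (Suc (Suc i)) + p)) q"
  by (simp add: mat_diff_def variable_cone_def sum_lessThan_plus)

text \<open>The alternating sign cancels the mixed terms of the squared differential. For a cycle
  \<open>(a, b)\<close>, first \<open>b = d b'\<close>; then \<open>a + (- 1)^i x b'\<close> is a
  cycle of \<open>F\<close>, hence equals \<open>d a'\<close>, and \<open>(a', b')\<close> is a
  preimage.\<close>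

lemma resolves_variable_cone:
  fixes F :: "('g::comm_monoid_add, 'n, 'k::field) free_complex"
  assumes F: "resolves_variable_ideal deg V F" and x: "x \<notin> V"
  shows "resolves_variable_ideal deg (insert x V) (variable_cone deg x F)"
    (is "resolves_variable_ideal _ _ ?C")
proof -
  define X :: "nat \<Rightarrow> ('n, 'k) polyring"
    where "X i = Poly_Mapping.single (Poly_Mapping.single x 1) ((- 1) ^ i)" for i
  have X0: "X 0 = Poly_Mapping.single (Poly_Mapping.single x 1) 1" by (simp add: X_def)
  have XSuc: "X (Suc i) = - X i" for i by (simp add: X_def single_uminus)
  let ?r = "res_rank F"
  have r0: "?r 0 = 1" and s0: "res_shift F 0 0 = 0" and aug: "res_aug F = (\<lambda>_. 1)"
    and hom: "\<And>i p q m. p < ?r (Suc i) \<Longrightarrow> q < ?r i \<Longrightarrow> m \<in> Poly_Mapping.keys (res_mat F i p q)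
        \<Longrightarrow> deg m + res_shift F i q = res_shift F (Suc i) p"
    and dd: "\<And>i v q. q < ?r i \<Longrightarrow> mat_diff F i (mat_diff F (Suc i) v) q = 0"
    and ex: "\<And>i v. (\<And>q. q < ?r i \<Longrightarrow> mat_diff F i v q = 0) \<Longrightarrow>
        \<exists>w. \<forall>p<?r (Suc i). v p = mat_diff F (Suc i) w p"
    and im: "{mat_diff F 0 w 0 |w. True} = variable_ideal V"
    using F unfolding resolves_variable_ideal_def by blast+
  have low: "mat_diff ?C i v q = mat_diff F i v q + v (?r (Suc i) + q) * X i"
    if "q < ?r i" for i v q
    unfolding X_def using that by (rule mat_diff_cone_low)
  note high = mat_diff_cone_high[of _ F _ deg x]
  have rC0: "res_rank ?C 0 = ?r 0" and rCS: "\<And>i. res_rank ?C (Suc i) = ?r (Suc i) + ?r i"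
    by (auto simp: variable_cone_def)
  \<comment> \<open>Each position lies in the block of \<open>F\<close> or, for positive
    \<open>i\<close>, in the shifted block.\<close>
  have index: "q < ?r i \<or> (\<exists>j q'. i = Suc j \<and> q = ?r i + q' \<and> q' < ?r j)"
    if "q < res_rank ?C i" for i q
  proof (cases i)
    case (Suc j)
    thus ?thesis using that rCS[of j] by (metis add_less_cancel_left le_Suc_ex not_less)
  qed (use that rC0 in auto)
  show ?thesis unfolding resolves_variable_ideal_def
  proof (intro conjI allI impI ballI)
    show "res_rank ?C 0 = 1" "res_shift ?C 0 0 = 0" "res_aug ?C = (\<lambda>_. 1)"
      using r0 s0 aug by (auto simp: variable_cone_def)
  next
    fix i p q m assume p: "p < res_rank ?C (Suc i)" and q: "q < res_rank ?C i"
      and m: "m \<in> Poly_Mapping.keys (res_mat ?C i p q)"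
    from index[OF q] show "deg m + res_shift ?C i q = res_shift ?C (Suc i) p"
    proof (elim disjE exE conjE)
      assume qi: "q < ?r i"
      show ?thesis
      proof (cases "p < ?r (Suc i)")
        case True
        thus ?thesis using hom[OF True qi] m qi by (simp add: variable_cone_def)
      next
        case False
        \<comment> \<open>Between the blocks the only nonzero entries are \<open>x\<close> up to
          sign, on the diagonal; its degree is the shift added to the second block.\<close>
        hence "p - ?r (Suc i) = q \<and> m = Poly_Mapping.single x 1"
          using m qi by (auto simp: variable_cone_def split: if_splits)
        thus ?thesis using False qi by (auto simp: variable_cone_def add.commute)
      qed
    next
      fix j q' assume j: "i = Suc j" "q = ?r i + q'" "q' < ?r j"
      hence np: "\<not> p < ?r (Suc i)" using m by (auto simp: variable_cone_def)
      hence "p - ?r (Suc i) < ?r i" using p rCS[of i] by simp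
      moreover have "m \<in> Poly_Mapping.keys (res_mat F j (p - ?r (Suc i)) q')"
        using m np j by (simp add: variable_cone_def)
      ultimately have "deg m + res_shift F j q' = res_shift F (Suc j) (p - ?r (Suc i))"
        using hom j by blast
      thus ?thesis using j np by (simp add: variable_cone_def add.assoc[symmetric])
    qed
  next
    fix i q and v :: "nat \<Rightarrow> ('n, 'k) polyring"
    assume q: "q < res_rank ?C i"
    let ?b = "\<lambda>p. v (?r (Suc (Suc i)) + p)"
    from index[OF q] show "mat_diff ?C i (mat_diff ?C (Suc i) v) q = 0"
    proof (elim disjE exE conjE)
      assume qi: "q < ?r i"
      have "mat_diff F i (mat_diff ?C (Suc i) v) q
          = mat_diff F i (\<lambda>p. mat_diff F (Suc i) v p + ?b p * X (Suc i)) q"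
        by (intro mat_diff_cong low)
      also have "\<dots> = mat_diff F i ?b q * X (Suc i)"
        using dd[OF qi] by (simp add: mat_diff_add mat_diff_mult)
      finally show ?thesis using qi by (simp add: low high XSuc)
    next
      fix j q' assume j: "i = Suc j" "q = ?r i + q'" "q' < ?r j"
      have "mat_diff ?C i (mat_diff ?C (Suc i) v) q
          = mat_diff F j (\<lambda>p. mat_diff ?C (Suc i) v (?r (Suc i) + p)) q'"
        using high[of q' j] j by simp
      also have "\<dots> = mat_diff F j (mat_diff F (Suc j) ?b) q'"
        using high[of _ "Suc j"] j(1) by (intro mat_diff_cong) simp
      finally show ?thesis using dd[OF j(3)] by simp
    qed
  next
    fix i and v :: "nat \<Rightarrow> ('n, 'k) polyring"
    assume z: "\<forall>q<res_rank ?C i. mat_diff ?C i v q = 0"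
    let ?b = "\<lambda>p. v (?r (Suc i) + p)"
    have zlow: "mat_diff F i v q + ?b q * X i = 0" if "q < ?r i" for q
    proof -
      have "q < res_rank ?C i" using that by (cases i) (auto simp: rC0 rCS)
      thus ?thesis using z low[OF that] by metis
    qed
    have "\<exists>b'. \<forall>p<?r i. ?b p = mat_diff F i b' p"
    proof (cases i)
      \<comment> \<open>No differential acts on \<open>b\<close> here. Instead \<open>x b\<close>
        lies in \<open>(V)\<close>; cancelling \<open>x\<close> puts \<open>b\<close> in
        \<open>(V)\<close>, the image of the first differential.\<close>
      case 0
      have "mat_diff F 0 v 0 + ?b 0 * X 0 = 0" using zlow[of 0] 0 r0 by simp
      hence "?b 0 * X 0 = mat_diff F 0 v 0 * (- 1)" by (simp add: eq_neg_iff_add_eq_0 add.commute)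
      also have "\<dots> = mat_diff F 0 (\<lambda>p. v p * (- 1)) 0" by (rule mat_diff_mult[symmetric])
      also have "\<dots> \<in> variable_ideal V" using im by blast
      finally have "?b 0 \<in> variable_ideal V" using variable_ideal_cancel x X0 by metis
      then obtain w where "?b 0 = mat_diff F 0 w 0" using im by blast
      thus ?thesis using 0 r0 by auto
    next
      case (Suc j)
      have "mat_diff F j ?b q = 0" if "q < ?r j" for q
        using high[OF that, of v] z that rCS[of j] Suc by auto
      thus ?thesis using ex[of j ?b] Suc by blast
    qed
    then obtain b' where b': "\<And>p. p < ?r i \<Longrightarrow> ?b p = mat_diff F i b' p" by blast
    have "mat_diff F i (\<lambda>p. v p + b' p * X i) q = 0" if "q < ?r i" for q
      using zlow[OF that] b'[OF that] by (simp add: mat_diff_add mat_diff_mult)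
    then obtain a' where a': "\<And>p. p < ?r (Suc i) \<Longrightarrow> v p + b' p * X i = mat_diff F (Suc i) a' p"
      using ex[of i "\<lambda>p. v p + b' p * X i"] by blast
    \<comment> \<open>The preimage \<open>(a', b')\<close>, with its two blocks
      concatenated.\<close>
    define w where "w s = (if s < ?r (Suc (Suc i)) then a' s else b' (s - ?r (Suc (Suc i))))" for s
    have "v p = mat_diff ?C (Suc i) w p" if p: "p < res_rank ?C (Suc i)" for p
    proof (cases "p < ?r (Suc i)")
      case True
      have "mat_diff F (Suc i) w p = mat_diff F (Suc i) a' p"
        by (intro mat_diff_cong) (simp add: w_def)
      hence "mat_diff ?C (Suc i) w p = mat_diff F (Suc i) a' p + b' p * X (Suc i)"
        using low[OF True] by (simp add: w_def)
      thus ?thesis using a'[OF True, symmetric] by (simp add: XSuc)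
    next
      case False
      then obtain p' where p': "p = ?r (Suc i) + p'" "p' < ?r i"
        using p rCS[of i] by (metis add_less_cancel_left le_Suc_ex not_less)
      thus ?thesis using high[OF p'(2), of w] b'[OF p'(2)] by (simp add: w_def)
    qed
    thus "\<exists>w. \<forall>p<res_rank ?C (Suc i). v p = mat_diff ?C (Suc i) w p" by blast
  next
    have D0: "mat_diff ?C 0 w 0 = mat_diff F 0 w 0 + w (?r (Suc 0)) * X 0" for w
      using low[of 0 0 w] r0 by simp
    show "{mat_diff ?C 0 w 0 |w. True} = variable_ideal (insert x V)"
    proof (intro equalityI subsetI)
      fix f assume "f \<in> {mat_diff ?C 0 w 0 |w. True}"
      then obtain w where "f = mat_diff F 0 w 0 + w (?r (Suc 0)) * X 0" using D0 by blast
      moreover have "mat_diff F 0 w 0 \<in> variable_ideal (insert x V)"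
        using im variable_ideal_mono[of V "insert x V"] by blast
      ultimately show "f \<in> variable_ideal (insert x V)"
        using variable_ideal_add variable_ideal_times X0 by metis
    next
      fix f :: "('n, 'k) polyring" assume "f \<in> variable_ideal (insert x V)"
      then obtain g h where gh: "g \<in> variable_ideal V" "f = g + h * X 0"
        unfolding X0 by (rule variable_ideal_insert_decompose)
      then obtain w where w: "g = mat_diff F 0 w 0" using im by blast
      \<comment> \<open>Since \<open>F\<close> has rank 1 in position 0, the second block has the
        single index \<open>?r (Suc 0)\<close>, which receives \<open>h\<close>.\<close>
      let ?w = "\<lambda>p. if p < ?r (Suc 0) then w p else h"
      have "mat_diff F 0 ?w 0 = g" unfolding w by (intro mat_diff_cong) simp
      hence "f = mat_diff ?C 0 ?w 0" using gh D0 by simp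
      thus "f \<in> {mat_diff ?C 0 w 0 |w. True}" by blast
    qed
  qed
qed

text \<open>The induction starts from \<open>R\<close> in position 0 alone; iterated cones yield the
  Koszul complex on \<open>V\<close>.\<close>

lemma resolves_variable_ideal_exists:
  assumes "finite V"
  shows "\<exists>F :: ('g::comm_monoid_add, 'n, 'k::field) free_complex. resolves_variable_ideal deg V F"
  using assms
proof (induction V)
  case empty
  let ?F = "\<lparr>res_rank = (\<lambda>i. if i = 0 then 1 else 0), res_shift = (\<lambda>i p. 0),
    res_mat = (\<lambda>i p q. 0), res_aug = (\<lambda>_. 1)\<rparr> :: ('g, 'n, 'k) free_complex"
  have "resolves_variable_ideal deg {} ?F"
    unfolding resolves_variable_ideal_def by (simp add: mat_diff_def variable_ideal_def)
  thus ?case by (rule exI)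
next
  case (insert x V)
  then obtain F :: "('g, 'n, 'k) free_complex" where "resolves_variable_ideal deg V F" by auto
  thus ?case using resolves_variable_cone insert.hyps(2) by (intro exI)
qed

section \<open>From coordinate functions to vectors\<close>

lemma lookup_res_diff:
  "Poly_Mapping.lookup (res_diff F i v) q
    = (if q < res_rank F i then mat_diff F i (Poly_Mapping.lookup v) q else 0)"
  by (simp add: res_diff_def mat_diff_def lookup_sum lookup_single when_def)

lemma res_diff_eq_0_iff:
  "res_diff F i v = 0 \<longleftrightarrow> (\<forall>q<res_rank F i. mat_diff F i (Poly_Mapping.lookup v) q = 0)"
  by (auto simp: poly_mapping_eq_iff lookup_res_diff fun_eq_iff)

text \<open>Truncating \<open>w\<close> at the rank makes it a vector without changing its
  image.\<close>

lemma res_diff_image_vecs: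
  "res_diff F i ` vecs UNIV (res_rank F (Suc i))
    = {v \<in> vecs UNIV (res_rank F i). \<exists>w. \<forall>q<res_rank F i. Poly_Mapping.lookup v q = mat_diff F i w q}"
  (is "?L = ?R")
proof (intro equalityI subsetI)
  fix v assume "v \<in> ?L"
  then obtain w where "v = res_diff F i w" by blast
  thus "v \<in> ?R" by (auto simp: vecs_def lookup_res_diff in_keys_iff split: if_splits)
next
  fix v assume v: "v \<in> ?R"
  then obtain w where w: "\<And>q. q < res_rank F i \<Longrightarrow> Poly_Mapping.lookup v q = mat_diff F i w q" by blast
  let ?w = "\<Sum>p<res_rank F (Suc i). Poly_Mapping.single p (w p)"
  have lw: "Poly_Mapping.lookup ?w p = (if p < res_rank F (Suc i) then w p else 0)" for p
    by (simp add: lookup_sum lookup_single when_def)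
  have "?w \<in> vecs UNIV (res_rank F (Suc i))"
    by (auto simp: vecs_def in_keys_iff lw split: if_splits)
  moreover have "v = res_diff F i ?w"
  proof (rule poly_mapping_eqI)
    fix q
    have "mat_diff F i (Poly_Mapping.lookup ?w) q = mat_diff F i w q"
      by (intro mat_diff_cong) (simp add: lw)
    thus "Poly_Mapping.lookup v q = Poly_Mapping.lookup (res_diff F i ?w) q"
      using v w by (auto simp: lookup_res_diff vecs_def in_keys_iff)
  qed
  ultimately show "v \<in> ?L" by blast
qed

lemma graded_free_resolution_exists:
  "\<exists>F :: ('g::comm_monoid_add, 'n::finite, 'k::field) free_complex. graded_free_resolution deg F"
proof -
  obtain F :: "('g, 'n, 'k) free_complex" where F: "resolves_variable_ideal deg UNIV F"
    using resolves_variable_ideal_exists[OF finite_UNIV, of deg] by blast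
  have r0: "res_rank F 0 = 1" and s0: "res_shift F 0 0 = 0" and aug: "res_aug F = (\<lambda>_. 1)"
    and hom: "\<forall>i. \<forall>p<res_rank F (Suc i). \<forall>q<res_rank F i. \<forall>m\<in>Poly_Mapping.keys (res_mat F i p q).
        deg m + res_shift F i q = res_shift F (Suc i) p"
    and dd: "\<And>i v q. q < res_rank F i \<Longrightarrow> mat_diff F i (mat_diff F (Suc i) v) q = 0"
    and ex: "\<And>i v. (\<And>q. q < res_rank F i \<Longrightarrow> mat_diff F i v q = 0) \<Longrightarrow>
        \<exists>w. \<forall>p<res_rank F (Suc i). v p = mat_diff F (Suc i) w p"
    and im: "{mat_diff F 0 w 0 |w. True} = variable_ideal UNIV"
    using F unfolding resolves_variable_ideal_def by blast+
  have augF: "res_augment F v = Poly_Mapping.lookup (Poly_Mapping.lookup v 0) 0" for v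
    by (simp add: res_augment_def aug r0)
  \<comment> \<open>With all variables in \<open>V\<close>, the quotient is \<open>k\<close>:
    membership in the ideal means that the constant coefficient vanishes.\<close>
  have vi: "f \<in> variable_ideal UNIV \<longleftrightarrow> Poly_Mapping.lookup f 0 = 0" for f :: "('n, 'k) polyring"
  proof -
    have "m \<noteq> 0 \<longleftrightarrow> (\<exists>v. Poly_Mapping.lookup m v > 0)" for m :: "'n monom"
      by (auto simp: poly_mapping_eq_iff fun_eq_iff)
    hence "f \<in> variable_ideal UNIV \<longleftrightarrow> (\<forall>m\<in>Poly_Mapping.keys f. m \<noteq> 0)"
      by (simp add: variable_ideal_def)
    thus ?thesis by (metis in_keys_iff)
  qed
  have "graded_free_resolution deg F" unfolding graded_free_resolution_def
  proof (intro conjI allI)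
    show "p < res_rank F (Suc i) \<longrightarrow> (\<forall>q<res_rank F i. \<forall>m\<in>Poly_Mapping.keys (res_mat F i p q).
        deg m + res_shift F i q = res_shift F (Suc i) p)" for i p
      using hom by blast
    show "p < res_rank F 0 \<longrightarrow> res_aug F p \<noteq> 0 \<longrightarrow> res_shift F 0 p = 0" for p
      using r0 s0 by simp
    show "res_augment F ` vecs UNIV (res_rank F 0) = UNIV"
    proof (intro equalityI subsetI)
      fix c :: 'k
      have "Poly_Mapping.single 0 (Poly_Mapping.single 0 c) \<in> vecs UNIV (res_rank F 0)"
        by (simp add: vecs_def r0)
      moreover have "c = res_augment F (Poly_Mapping.single 0 (Poly_Mapping.single 0 c))"
        by (simp add: augF)
      ultimately show "c \<in> res_augment F ` vecs UNIV (res_rank F 0)" by blast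
    qed simp
    have "res_augment F v = 0 \<longleftrightarrow> (\<exists>w. \<forall>q<res_rank F 0. Poly_Mapping.lookup v q = mat_diff F 0 w q)" for v
    proof -
      have "res_augment F v = 0 \<longleftrightarrow> Poly_Mapping.lookup v 0 \<in> {mat_diff F 0 w 0 |w. True}"
        unfolding im vi augF ..
      thus ?thesis by (simp add: r0)
    qed
    thus "{v \<in> vecs UNIV (res_rank F 0). res_augment F v = 0}
       = res_diff F 0 ` vecs UNIV (res_rank F 1)"
      using res_diff_image_vecs[of F 0] by simp
    fix i
    have "res_diff F i v = 0 \<longleftrightarrow>
      (\<exists>w. \<forall>q<res_rank F (Suc i). Poly_Mapping.lookup v q = mat_diff F (Suc i) w q)" for v
    proof
      assume "\<exists>w. \<forall>q<res_rank F (Suc i). Poly_Mapping.lookup v q = mat_diff F (Suc i) w q"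
      then obtain w where w: "\<And>q. q < res_rank F (Suc i) \<Longrightarrow>
        Poly_Mapping.lookup v q = mat_diff F (Suc i) w q" by blast
      have "mat_diff F i (Poly_Mapping.lookup v) q = mat_diff F i (mat_diff F (Suc i) w) q" for q
        using w by (intro mat_diff_cong)
      thus "res_diff F i v = 0" using dd by (simp add: res_diff_eq_0_iff)
    qed (use ex res_diff_eq_0_iff in blast)
    thus "{v \<in> vecs UNIV (res_rank F (Suc i)). res_diff F i v = 0}
       = res_diff F (Suc i) ` vecs UNIV (res_rank F (Suc (Suc i)))"
      unfolding res_diff_image_vecs by simp
  qed
  thus ?thesis by blast
qed

section \<open>Tor as a space over the field\<close>

lemma lookup_kscale:
  "Poly_Mapping.lookup (kscale c v) p = Poly_Mapping.single 0 c * Poly_Mapping.lookup v p"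
  by (simp add: kscale_def Poly_Mapping.map.rep_eq when_def)

interpretation kspace: vector_space kscale
proof
  fix a b :: 'a and x y :: "nat \<Rightarrow>\<^sub>0 ('b, 'a) polyring"
  show "kscale a (x + y) = kscale a x + kscale a y"
    by (rule poly_mapping_eqI) (simp add: lookup_kscale lookup_add distrib_left)
  show "kscale (a + b) x = kscale a x + kscale b x"
    by (rule poly_mapping_eqI) (simp add: lookup_kscale lookup_add single_add distrib_right)
  show "kscale a (kscale b x) = kscale (a * b) x"
    by (rule poly_mapping_eqI) (simp add: lookup_kscale mult.assoc[symmetric] mult_single)
  show "kscale 1 x = x"
    by (rule poly_mapping_eqI) (simp add: lookup_kscale)
qed

lemma lookup_lookup_kscale:
  "Poly_Mapping.lookup (Poly_Mapping.lookup (kscale c v) p) m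
    = c * Poly_Mapping.lookup (Poly_Mapping.lookup v p) m"
  using lookup_times_single[of "Poly_Mapping.lookup v p" 0 c m] by (simp add: lookup_kscale mult.commute)

lemma module_hom_res_diff: "module_hom kscale kscale (res_diff F i)"
proof (intro module_hom.intro module_hom_axioms.intro kspace.module_axioms)
  show "res_diff F i (v + w) = res_diff F i v + res_diff F i w" for v w
  proof (rule poly_mapping_eqI)
    fix q
    have "Poly_Mapping.lookup (v + w) = (\<lambda>p. Poly_Mapping.lookup v p + Poly_Mapping.lookup w p)"
      by (simp add: lookup_add fun_eq_iff)
    hence "mat_diff F i (Poly_Mapping.lookup (v + w)) q
        = mat_diff F i (Poly_Mapping.lookup v) q + mat_diff F i (Poly_Mapping.lookup w) q"
      by (simp only: mat_diff_add)
    thus "Poly_Mapping.lookup (res_diff F i (v + w)) q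
        = Poly_Mapping.lookup (res_diff F i v + res_diff F i w) q"
      by (simp add: lookup_res_diff lookup_add)
  qed
  show "res_diff F i (kscale c v) = kscale c (res_diff F i v)" for c v
  proof (rule poly_mapping_eqI)
    fix q
    have "Poly_Mapping.lookup (kscale c v) = (\<lambda>p. Poly_Mapping.lookup v p * Poly_Mapping.single 0 c)"
      by (simp add: lookup_kscale fun_eq_iff mult.commute)
    hence "mat_diff F i (Poly_Mapping.lookup (kscale c v)) q
        = mat_diff F i (Poly_Mapping.lookup v) q * Poly_Mapping.single 0 c"
      by (simp only: mat_diff_mult)
    thus "Poly_Mapping.lookup (res_diff F i (kscale c v)) q
        = Poly_Mapping.lookup (kscale c (res_diff F i v)) q"
      by (simp add: lookup_res_diff lookup_kscale mult.commute)
  qed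
qed

text \<open>Quotient bases exist and all have the same size, so the definite description in
  \<open>quotient_dim\<close> denotes that size. If it is 0, the basis is empty and each element of
  \<open>Z\<close> is already in \<open>B\<close>.\<close>

lemma quotient_dim_add_dim:
  assumes Z: "kspace.subspace Z" "Z \<subseteq> kspace.span T" "finite T"
    and B: "kspace.subspace B" "B \<subseteq> Z"
  shows "quotient_dim Z B + kspace.dim B = kspace.dim Z"
    and "quotient_dim Z B = 0 \<Longrightarrow> Z = B"
proof -
  have qd: "quotient_dim Z B = (THE d. \<exists>S. kspace.quotient_basis S Z B \<and> card S = d)"
    unfolding quotient_dim_def kspace.quotient_basis_def
    by (intro arg_cong[where f = The] ext) blast
  obtain S where S: "kspace.quotient_basis S Z B"
    using kspace.quotient_basis_exists[OF Z(2,3) B] .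
  have card: "card S + kspace.dim B = kspace.dim Z" if "kspace.quotient_basis S Z B" for S
    using kspace.card_quotient_basis[OF Z B that] .
  have "quotient_dim Z B = card S"
    unfolding qd
  proof (rule the_equality)
    show "\<exists>S'. kspace.quotient_basis S' Z B \<and> card S' = card S" using S by blast
    show "d = card S" if "\<exists>S'. kspace.quotient_basis S' Z B \<and> card S' = d" for d
      using that card card[OF S] by (metis add_right_cancel)
  qed
  thus "quotient_dim Z B + kspace.dim B = kspace.dim Z" using card[OF S] by simp
  assume "quotient_dim Z B = 0"
  hence "S = {}" using \<open>quotient_dim Z B = card S\<close> S by (simp add: kspace.quotient_basis_def)
  hence "Z \<subseteq> B" using S by (auto simp: kspace.quotient_basis_def)
  thus "Z = B" using B by blast
qed

section \<open>Betti splittings\<close>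

text \<open>Both gradings are covered at once: additivity makes the differential homogeneous, and
  finite fibres make each graded part finite-dimensional over \<open>k\<close>.\<close>

locale graded_resolution =
  fixes deg :: "'n monom \<Rightarrow> 'g::comm_monoid_add" and F :: "('g, 'n, 'k::field) free_complex"
  assumes deg_add: "deg (a + b) = deg a + deg b"
    and finite_fibre: "finite {m. deg m + s = j}"
    and resolution: "graded_free_resolution deg F"
begin

section \<open>Chains of a fixed degree\<close>

abbreviation chains :: "'n monom set \<Rightarrow> nat \<Rightarrow> 'g \<Rightarrow> (nat \<Rightarrow>\<^sub>0 ('n, 'k) polyring) set" where
  "chains U i j \<equiv> graded_part deg F (supported_on U) i j"

abbreviation cycles :: "'n monom set \<Rightarrow> nat \<Rightarrow> 'g \<Rightarrow> (nat \<Rightarrow>\<^sub>0 ('n, 'k) polyring) set" where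
  "cycles U i j \<equiv> tor_cycles deg F (supported_on U) i j"

abbreviation boundaries :: "'n monom set \<Rightarrow> nat \<Rightarrow> 'g \<Rightarrow> (nat \<Rightarrow>\<^sub>0 ('n, 'k) polyring) set" where
  "boundaries U i j \<equiv> tor_boundaries deg F (supported_on U) i j"

lemma chains_iff:
  "v \<in> chains U i j \<longleftrightarrow> (\<forall>p m. Poly_Mapping.lookup (Poly_Mapping.lookup v p) m \<noteq> 0 \<longrightarrow>
      p < res_rank F i \<and> m \<in> U \<and> deg m + res_shift F i p = j)"
proof -
  have "Poly_Mapping.keys v \<subseteq> {..<res_rank F i} \<longleftrightarrow>
      (\<forall>p m. Poly_Mapping.lookup (Poly_Mapping.lookup v p) m \<noteq> 0 \<longrightarrow> p < res_rank F i)"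
    by (auto simp: in_keys_iff subset_iff poly_mapping_eq_iff[of "Poly_Mapping.lookup v _"] fun_eq_iff)
  thus ?thesis
    unfolding graded_part_def vecs_def supported_on_def by (auto simp: in_keys_iff subset_iff)
qed

lemma subspace_chains: "kspace.subspace (chains U i j)"
  unfolding kspace.subspace_def
proof (intro conjI ballI allI)
  fix v w assume vw: "v \<in> chains U i j" "w \<in> chains U i j"
  show "v + w \<in> chains U i j" unfolding chains_iff
  proof (intro allI impI)
    fix p m assume "Poly_Mapping.lookup (Poly_Mapping.lookup (v + w) p) m \<noteq> 0"
    hence "Poly_Mapping.lookup (Poly_Mapping.lookup v p) m \<noteq> 0
      \<or> Poly_Mapping.lookup (Poly_Mapping.lookup w p) m \<noteq> 0"
      by (auto simp: lookup_add)
    thus "p < res_rank F i \<and> m \<in> U \<and> deg m + res_shift F i p = j"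
      using vw unfolding chains_iff by blast
  qed
qed (auto simp: chains_iff lookup_lookup_kscale)

text \<open>The exponent set does not occur, so one finite set spans the chains of all ideals in a
  given position and degree. The dimension formula for sums requires such a common bound.\<close>

definition chain_basis :: "nat \<Rightarrow> 'g \<Rightarrow> (nat \<Rightarrow>\<^sub>0 ('n, 'k) polyring) set" where
  "chain_basis i j = (\<lambda>(p, m). Poly_Mapping.single p (Poly_Mapping.single m 1))
     ` (SIGMA p:{..<res_rank F i}. {m. deg m + res_shift F i p = j})"

lemma finite_chain_basis: "finite (chain_basis i j)"
  unfolding chain_basis_def using finite_fibre by auto

lemma chain_basisI:
  "p < res_rank F i \<Longrightarrow> deg m + res_shift F i p = j \<Longrightarrow>
    Poly_Mapping.single p (Poly_Mapping.single m 1) \<in> chain_basis i j"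
  unfolding chain_basis_def by (intro image_eqI[of _ _ "(p, m)"]) auto

lemma chains_subset_span: "chains U i j \<subseteq> kspace.span (chain_basis i j)"
proof
  fix v assume v: "v \<in> chains U i j"
  have kscale_single: "kscale c (Poly_Mapping.single p (Poly_Mapping.single m 1))
      = Poly_Mapping.single p (Poly_Mapping.single m c)" for c :: 'k and p :: nat and m :: "'n monom"
    by (rule poly_mapping_eqI) (simp add: lookup_kscale lookup_single when_def mult_single)
  have single_sum: "Poly_Mapping.single p (sum g A) = (\<Sum>a\<in>A. Poly_Mapping.single p (g a))"
    for p :: nat and g :: "'n monom \<Rightarrow> ('n, 'k) polyring" and A
    by (induction A rule: infinite_finite_induct) (simp_all add: single_add)
  have "v = (\<Sum>p\<in>Poly_Mapping.keys v. Poly_Mapping.single p (Poly_Mapping.lookup v p))"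
    by (rule poly_mapping_sum_single)
  also have "\<dots> = (\<Sum>p\<in>Poly_Mapping.keys v. \<Sum>m\<in>Poly_Mapping.keys (Poly_Mapping.lookup v p).
      kscale (Poly_Mapping.lookup (Poly_Mapping.lookup v p) m) (Poly_Mapping.single p (Poly_Mapping.single m 1)))"
    by (simp add: kscale_single single_sum[symmetric] poly_mapping_sum_single[symmetric])
  also have "\<dots> \<in> kspace.span (chain_basis i j)"
  proof (intro kspace.span_sum kspace.span_scale kspace.span_base chain_basisI)
    fix p m assume "m \<in> Poly_Mapping.keys (Poly_Mapping.lookup v p)"
    hence "p < res_rank F i \<and> m \<in> U \<and> deg m + res_shift F i p = j"
      using v unfolding chains_iff in_keys_iff by blast
    thus "p < res_rank F i" "deg m + res_shift F i p = j" by auto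
  qed
  finally show "v \<in> kspace.span (chain_basis i j)" .
qed

lemma chains_Int: "chains (U \<inter> V) i j = chains U i j \<inter> chains V i j"
  by (auto simp: chains_iff)

text \<open>Split a chain term by term: terms with exponent in \<open>U\<close> form one summand,
  and the remaining ones have exponents in \<open>V\<close>.\<close>

lemma chains_Un: "chains (U \<union> V) i j = {v + w |v w. v \<in> chains U i j \<and> w \<in> chains V i j}"
proof (intro equalityI subsetI)
  fix v assume v: "v \<in> chains (U \<union> V) i j"
  let ?f = "\<lambda>p. \<Sum>m\<in>Poly_Mapping.keys (Poly_Mapping.lookup v p) \<inter> U.
      Poly_Mapping.single m (Poly_Mapping.lookup (Poly_Mapping.lookup v p) m)"
  let ?x = "\<Sum>p\<in>Poly_Mapping.keys v. Poly_Mapping.single p (?f p)"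
  have f: "Poly_Mapping.lookup (?f p) m
      = (if m \<in> U then Poly_Mapping.lookup (Poly_Mapping.lookup v p) m else 0)" for p m
    by (simp add: lookup_sum lookup_single when_def in_keys_iff)
  have "Poly_Mapping.lookup ?x p = ?f p" for p
    by (simp add: lookup_sum[of "\<lambda>p. Poly_Mapping.single p (?f p)"] lookup_single when_def in_keys_iff)
  hence x: "Poly_Mapping.lookup (Poly_Mapping.lookup ?x p) m
      = (if m \<in> U then Poly_Mapping.lookup (Poly_Mapping.lookup v p) m else 0)" for p m
    using f by simp
  have "?x \<in> chains U i j" using v unfolding chains_iff x by (auto split: if_splits)
  moreover have "v - ?x \<in> chains V i j"
    using v unfolding chains_iff lookup_minus x by (auto split: if_splits)
  moreover have "v = ?x + (v - ?x)" by simp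
  ultimately show "v \<in> {v + w |v w. v \<in> chains U i j \<and> w \<in> chains V i j}" by blast
next
  fix u assume "u \<in> {v + w |v w. v \<in> chains U i j \<and> w \<in> chains V i j}"
  then obtain v w where "u = v + w" "v \<in> chains U i j" "w \<in> chains V i j" by blast
  moreover from this have "v \<in> chains (U \<union> V) i j" "w \<in> chains (U \<union> V) i j"
    unfolding chains_iff by blast+
  ultimately show "u \<in> chains (U \<union> V) i j" using kspace.subspace_add[OF subspace_chains] by blast
qed

text \<open>A term of the image comes from a term of \<open>v\<close> times a term of a matrix
  entry. Upward closure keeps the exponent in \<open>U\<close>, and homogeneity of the matrix keeps
  the degree.\<close>

lemma res_diff_chains:
  assumes U: "upward_closed U" and v: "v \<in> chains U (Suc i) j"
  shows "res_diff F i v \<in> chains U i j"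
  unfolding chains_iff
proof (intro allI impI)
  fix q m assume "Poly_Mapping.lookup (Poly_Mapping.lookup (res_diff F i v) q) m \<noteq> 0"
  hence q: "q < res_rank F i"
    and "m \<in> Poly_Mapping.keys (\<Sum>p<res_rank F (Suc i). Poly_Mapping.lookup v p * res_mat F i p q)"
    by (auto simp: lookup_res_diff mat_diff_def in_keys_iff split: if_splits)
  then obtain p where p: "p < res_rank F (Suc i)"
    "m \<in> Poly_Mapping.keys (Poly_Mapping.lookup v p * res_mat F i p q)"
    using keys_sum[of "\<lambda>p. Poly_Mapping.lookup v p * res_mat F i p q"] by blast
  then obtain a b where m: "m = a + b" "a \<in> Poly_Mapping.keys (Poly_Mapping.lookup v p)"
    "b \<in> Poly_Mapping.keys (res_mat F i p q)"
    using keys_mult[of "Poly_Mapping.lookup v p" "res_mat F i p q"] by blast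
  have "a \<in> U" "deg a + res_shift F (Suc i) p = j"
    using v m(2) unfolding chains_iff in_keys_iff by blast+
  moreover have "deg b + res_shift F i q = res_shift F (Suc i) p"
    using resolution[unfolded graded_free_resolution_def, THEN conjunct1] p(1) q m(3) by simp
  ultimately show "q < res_rank F i \<and> m \<in> U \<and> deg m + res_shift F i q = j"
    using U q m(1) by (simp add: upward_closed_def deg_add add.assoc)
qed

lemma res_diff_res_diff:
  assumes "v \<in> chains U (Suc (Suc i)) j"
  shows "res_diff F i (res_diff F (Suc i) v) = 0"
proof -
  have "v \<in> vecs UNIV (res_rank F (Suc (Suc i)))"
    using assms by (auto simp: graded_part_def vecs_def)
  moreover have "{v \<in> vecs UNIV (res_rank F (Suc i)). res_diff F i v = 0}
      = res_diff F (Suc i) ` vecs UNIV (res_rank F (Suc (Suc i)))"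
    using resolution unfolding graded_free_resolution_def by (elim conjE allE)
  ultimately show ?thesis by blast
qed

section \<open>Cycles, boundaries and Tor\<close>

lemma subspace_cycles: "kspace.subspace (cycles U i j)"
proof (cases i)
  case (Suc i')
  interpret d: module_hom kscale kscale "res_diff F i'" by (rule module_hom_res_diff)
  have "cycles U i j = chains U i j \<inter> {v. res_diff F i' v = 0}"
    unfolding tor_cycles_def Suc by auto
  thus ?thesis using kspace.subspace_inter[OF subspace_chains d.subspace_kernel] by simp
qed (simp add: tor_cycles_def subspace_chains)

lemma subspace_boundaries: "kspace.subspace (boundaries U i j)"
  unfolding tor_boundaries_def
  by (rule module_hom.subspace_image[OF module_hom_res_diff subspace_chains])

lemma cycles_subset: "cycles U i j \<subseteq> chains U i j"
  by (auto simp: tor_cycles_def split: nat.splits)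

lemma boundaries_subset:
  assumes "upward_closed U"
  shows "boundaries U i j \<subseteq> cycles U i j"
  using res_diff_chains[OF assms] res_diff_res_diff
  by (auto simp: tor_cycles_def tor_boundaries_def split: nat.splits)

lemma cycles_Int: "cycles (U \<inter> V) i j = cycles U i j \<inter> cycles V i j"
  by (auto simp: tor_cycles_def chains_Int split: nat.splits)

lemma boundaries_mono: "U \<subseteq> V \<Longrightarrow> boundaries U i j \<subseteq> boundaries V i j"
  unfolding tor_boundaries_def by (intro image_mono subsetI) (auto simp: chains_iff subset_iff)

lemma boundaries_Un:
  "boundaries (U \<union> V) i j = {v + w |v w. v \<in> boundaries U i j \<and> w \<in> boundaries V i j}"
proof -
  interpret d: module_hom kscale kscale "res_diff F i" by (rule module_hom_res_diff)
  let ?B = "\<lambda>U. res_diff F i ` chains U (Suc i) j"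
  show ?thesis unfolding tor_boundaries_def chains_Un
  proof (intro equalityI subsetI)
    fix z assume "z \<in> {v + w |v w. v \<in> ?B U \<and> w \<in> ?B V}"
    then obtain v w where "z = res_diff F i (v + w)" "v \<in> chains U (Suc i) j" "w \<in> chains V (Suc i) j"
      by (auto simp: d.add)
    thus "z \<in> res_diff F i ` {v + w |v w. v \<in> chains U (Suc i) j \<and> w \<in> chains V (Suc i) j}" by blast
  next
    fix z assume "z \<in> res_diff F i ` {v + w |v w. v \<in> chains U (Suc i) j \<and> w \<in> chains V (Suc i) j}"
    then obtain v w where "z = res_diff F i v + res_diff F i w"
      "v \<in> chains U (Suc i) j" "w \<in> chains V (Suc i) j"
      by (auto simp: d.add)
    thus "z \<in> {v + w |v w. v \<in> ?B U \<and> w \<in> ?B V}" by blast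
  qed
qed

lemma dim_cycles_boundaries:
  "kspace.dim (cycles U (Suc i) j) + kspace.dim (boundaries U i j) = kspace.dim (chains U (Suc i) j)"
  unfolding tor_cycles_def tor_boundaries_def nat.case
  by (rule kspace.dim_kernel_image[OF module_hom_res_diff subspace_chains
        chains_subset_span finite_chain_basis])

definition tor_dim :: "'n monom set \<Rightarrow> nat \<Rightarrow> 'g \<Rightarrow> nat" where
  "tor_dim U i j = quotient_dim (cycles U i j) (boundaries U i j)"

lemma tor_dim_add:
  assumes U: "upward_closed U"
  shows "tor_dim U i j + kspace.dim (boundaries U i j) = kspace.dim (cycles U i j)"
    and "tor_dim U i j = 0 \<Longrightarrow> cycles U i j = boundaries U i j"
proof -
  note qd = quotient_dim_add_dim[OF subspace_cycles subset_trans[OF cycles_subset chains_subset_span]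
      finite_chain_basis subspace_boundaries boundaries_subset[OF U]]
  show "tor_dim U i j + kspace.dim (boundaries U i j) = kspace.dim (cycles U i j)"
    unfolding tor_dim_def by (rule qd(1))
  show "tor_dim U i j = 0 \<Longrightarrow> cycles U i j = boundaries U i j"
    unfolding tor_dim_def by (rule qd(2))
qed

section \<open>Two ideals, their sum and their intersection\<close>

context
  fixes U V :: "'n monom set"
  assumes U: "upward_closed U" and V: "upward_closed V"
begin

text \<open>
  For \<open>J\<close>, \<open>K\<close> with exponent sets \<open>U\<close>, \<open>V\<close>, this says that
  \<open>Tor\<^sub>i(k, J \<inter> K)\<^sub>j \<rightarrow> Tor\<^sub>i(k, J)\<^sub>j \<oplus> Tor\<^sub>i(k, K)\<^sub>j\<close> vanishes.
\<close>

lemma boundaries_Int: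
  assumes vanish: "tor_dim (U \<inter> V) i j > 0 \<longrightarrow> tor_dim U i j = 0 \<and> tor_dim V i j = 0"
  shows "boundaries U i j \<inter> boundaries V i j = cycles (U \<inter> V) i j"
proof
  show "boundaries U i j \<inter> boundaries V i j \<subseteq> cycles (U \<inter> V) i j"
    unfolding cycles_Int using boundaries_subset[OF U] boundaries_subset[OF V] by (rule Int_mono)
  show "cycles (U \<inter> V) i j \<subseteq> boundaries U i j \<inter> boundaries V i j"
  proof (cases "tor_dim (U \<inter> V) i j = 0")
    case True
    hence "cycles (U \<inter> V) i j = boundaries (U \<inter> V) i j"
      using tor_dim_add(2)[of "U \<inter> V" i j] U V by (simp add: upward_closed_def)
    thus ?thesis using boundaries_mono by auto
  next
    case False
    hence "cycles U i j = boundaries U i j" "cycles V i j = boundaries V i j"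
      using vanish tor_dim_add(2) U V by auto
    thus ?thesis by (simp add: cycles_Int)
  qed
qed

lemma dim_chains_Un:
  "kspace.dim (chains (U \<union> V) i j) + kspace.dim (chains (U \<inter> V) i j)
    = kspace.dim (chains U i j) + kspace.dim (chains V i j)"
proof -
  show ?thesis
    unfolding chains_Un chains_Int
    by (rule kspace.dim_sum_Int[OF subspace_chains chains_subset_span subspace_chains chains_subset_span finite_chain_basis])
qed

text \<open>The dimension formula for a sum of subspaces, where by the vanishing hypothesis the
  intersection consists of all cycles of \<open>U \<inter> V\<close>.\<close>

lemma dim_boundaries_Un:
  assumes "tor_dim (U \<inter> V) i j > 0 \<longrightarrow> tor_dim U i j = 0 \<and> tor_dim V i j = 0"
  shows "kspace.dim (boundaries (U \<union> V) i j) + kspace.dim (cycles (U \<inter> V) i j)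
    = kspace.dim (boundaries U i j) + kspace.dim (boundaries V i j)"
proof -
  have "boundaries U i j \<subseteq> kspace.span (chain_basis i j)" "boundaries V i j \<subseteq> kspace.span (chain_basis i j)"
    using boundaries_subset[OF U] boundaries_subset[OF V] cycles_subset chains_subset_span by (meson subset_trans)+
  thus ?thesis
    using kspace.dim_sum_Int[OF subspace_boundaries _ subspace_boundaries _ finite_chain_basis]
    by (simp add: boundaries_Un boundaries_Int[OF assms, symmetric])
qed

text \<open>By rank-nullity, each Tor dimension in positive position is the dimension of the chains
  minus those of the boundaries in positions \<open>i\<close> and \<open>i - 1\<close>. Adding the
  formulas for unions cancels everything but the cycles minus the boundaries of
  \<open>U \<inter> V\<close> in position \<open>i - 1\<close>.\<close>

lemma tor_dim_Un:
  assumes vanish: "\<And>i. tor_dim (U \<inter> V) i j > 0 \<longrightarrow> tor_dim U i j = 0 \<and> tor_dim V i j = 0"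
  shows "tor_dim (U \<union> V) i j = tor_dim U i j + tor_dim V i j
    + (case i of 0 \<Rightarrow> 0 | Suc i' \<Rightarrow> tor_dim (U \<inter> V) i' j)"
proof -
  have UV: "upward_closed (U \<union> V)" and IV: "upward_closed (U \<inter> V)"
    using U V by (auto simp: upward_closed_def)
  note dims = tor_dim_add(1)[OF U, of i j] tor_dim_add(1)[OF V, of i j]
    tor_dim_add(1)[OF UV, of i j] dim_chains_Un[of i j] dim_boundaries_Un[OF vanish, of i]
  show ?thesis
  proof (cases i)
    \<comment> \<open>In position 0 every chain is a cycle, so the chain formula replaces
      rank-nullity.\<close>
    case 0
    hence "cycles W i j = chains W i j" for W by (simp add: tor_cycles_def)
    hence "tor_dim (U \<union> V) i j = tor_dim U i j + tor_dim V i j"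
      using dims by presburger
    thus ?thesis using 0 by simp
  next
    case (Suc i')
    have "tor_dim (U \<union> V) i j = tor_dim U i j + tor_dim V i j + tor_dim (U \<inter> V) i' j"
      using dims[unfolded Suc] tor_dim_add(1)[OF IV, of i' j] dim_boundaries_Un[OF vanish, of i']
        dim_cycles_boundaries[of U i' j] dim_cycles_boundaries[of V i' j]
        dim_cycles_boundaries[of "U \<union> V" i' j] dim_cycles_boundaries[of "U \<inter> V" i' j]
      unfolding Suc by linarith
    thus ?thesis using Suc by simp
  qed
qed

end

end

section \<open>Betti numbers in the two gradings\<close>

lemma betti_splitting_if_vanishing:
  fixes deg :: "'n::finite monom \<Rightarrow> 'g::comm_monoid_add" and I J K :: "('n, 'k::field) polyring set"
  assumes deg_add: "\<And>a b. deg (a + b) = deg a + deg b"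
    and finite_fibre: "\<And>s j. finite {m. deg m + s = j}"
    and ideals: "monomial_ideal I" "monomial_ideal J" "monomial_ideal K"
    and gens: "min_gens I = min_gens J \<union> min_gens K" "min_gens J \<inter> min_gens K = {}"
    and vanish: "\<And>(i::nat) j. betti deg (int i) j (J \<inter> K) > 0 \<Longrightarrow>
      betti deg (int i) j J = 0 \<and> betti deg (int i) j K = 0"
  shows "betti_splitting deg I J K"
proof -
  \<comment> \<open>The resolution that \<open>betti\<close> chooses depends on the grading but not
    on the ideal, so all Betti numbers involved are computed from the same complex.\<close>
  define F :: "('g, 'n, 'k) free_complex" where "F = (SOME F. graded_free_resolution deg F)"
  have "graded_free_resolution deg F"
    unfolding F_def using graded_free_resolution_exists by (rule someI_ex)
  then interpret graded_resolution deg F using deg_add finite_fibre by unfold_locales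
  obtain U V where UV: "upward_closed U" "upward_closed V"
    and J: "J = supported_on U" and K: "K = supported_on V"
    and I: "I = supported_on (U \<union> V)"
    using monomial_ideal_sum_exps[OF ideals gens(1)] by metis
  have JK: "J \<inter> K = supported_on (U \<inter> V)" unfolding J K supported_on_def by blast
  have betti: "betti deg (int i) j (supported_on W :: ('n, 'k) polyring set) = tor_dim W i j" for i j W
    by (simp add: betti_def tor_dim_def Let_def F_def[symmetric])
  \<comment> \<open>For \<open>i = 0\<close> the integer index is -1, where \<open>betti\<close> is
    0 by convention.\<close>
  have betti_pred: "betti deg (int i - 1) j (J \<inter> K)
      = (case i of 0 \<Rightarrow> 0 | Suc i' \<Rightarrow> tor_dim (U \<inter> V) i' j)" for i j
  proof (cases i)
    case (Suc i')
    thus ?thesis unfolding JK using betti[of i' j "U \<inter> V"] by simp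
  qed (simp add: betti_def)
  have "tor_dim (U \<inter> V) i j > 0 \<longrightarrow> tor_dim U i j = 0 \<and> tor_dim V i j = 0" for i j
    using vanish[of i j] unfolding JK unfolding J K betti by blast
  from tor_dim_Un[OF UV this] show ?thesis
    unfolding betti_splitting_def using gens betti_pred
    unfolding JK unfolding I J K betti by simp
qed

text \<open>Each exponent is bounded by the total degree, so the monomials embed into a finite set
  of functions on the variables.\<close>

lemma finite_std_degree_fibre: "finite {m. std_degree m + s = (j::nat)}"
proof -
  have "Poly_Mapping.lookup ` {m :: 'a monom. std_degree m + s = j} \<subseteq> Pi\<^sub>E UNIV (\<lambda>_. {..j})"
  proof (intro image_subsetI PiE_I)
    fix m :: "'a monom" and v assume "m \<in> {m. std_degree m + s = j}"
    moreover have "Poly_Mapping.lookup m v \<le> std_degree m"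
      unfolding std_degree_def by (rule member_le_sum) auto
    ultimately show "Poly_Mapping.lookup m v \<in> {..j}" by simp
  qed simp
  hence "finite (Poly_Mapping.lookup ` {m :: 'a monom. std_degree m + s = j})"
    by (rule finite_subset) (intro finite_PiE, auto)
  moreover have "inj_on Poly_Mapping.lookup A" for A :: "'a monom set"
    by (intro inj_onI poly_mapping_eqI) simp
  ultimately show ?thesis by (rule finite_imageD)
qed

text \<open>Addition of exponent vectors is cancellative, so a multidegree determines the
  monomial.\<close>

lemma finite_multi_degree_fibre: "finite {m. multi_degree m + s = j}"
proof (rule finite_subset)
  show "{m. multi_degree m + s = j} \<subseteq> {j - s}" by (auto simp: multi_degree_def)
qed simp

theorem theorem2p3:
  fixes I J K :: "('n::finite, 'k::field) polyring set"
  assumes "monomial_ideal I" and "monomial_ideal J" and "monomial_ideal K"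
    and "min_gens I = min_gens J \<union> min_gens K"
    and "min_gens J \<inter> min_gens K = {}"
  shows
    "((\<forall>(i::nat) j. betti std_degree (int i) j (J \<inter> K) > 0 \<longrightarrow>
         betti std_degree (int i) j J = 0 \<and> betti std_degree (int i) j K = 0)
       \<longrightarrow> betti_splitting std_degree I J K)
     \<and>
     ((\<forall>(i::nat) j. betti multi_degree (int i) j (J \<inter> K) > 0 \<longrightarrow>
         betti multi_degree (int i) j J = 0 \<and> betti multi_degree (int i) j K = 0)
       \<longrightarrow> betti_splitting multi_degree I J K)"
proof (intro conjI impI)
  assume *: "\<forall>(i::nat) j. betti std_degree (int i) j (J \<inter> K) > 0 \<longrightarrow>
         betti std_degree (int i) j J = 0 \<and> betti std_degree (int i) j K = 0"
  show "betti_splitting std_degree I J K"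
    by (rule betti_splitting_if_vanishing[OF std_degree_add finite_std_degree_fibre assms *[rule_format]])
next
  assume *: "\<forall>(i::nat) j. betti multi_degree (int i) j (J \<inter> K) > 0 \<longrightarrow>
         betti multi_degree (int i) j J = 0 \<and> betti multi_degree (int i) j K = 0"
  have "multi_degree (a + b) = multi_degree a + multi_degree b" for a b :: "'n monom"
    by (simp add: multi_degree_def)
  from betti_splitting_if_vanishing[OF this finite_multi_degree_fibre assms *[rule_format]]
  show "betti_splitting multi_degree I J K" .
qed

end
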